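(* Let $f(x)\in\mathbb{Z}[x]$ be a monic polynomial and let $k\geq 2$ be an integer such that $f(x^k)$ is irreducible over $\mathbb{Q}$. Then $f(x^k)$ is monogenic if and only if all of the following hold: (1) $f(x)$ is monogenic; (2) for every prime $p$ dividing $k$, $p$ does not divide the index of $f(x^p)$; (3) $f(0)$ is squarefree.
   Context: For a monic irreducible polynomial $g(x)\in\mathbb{Z}[x]$ with a root $\theta$, let $K=\mathbb{Q}(\theta)$ and $\mathbb{Z}_K$ its ring of algebraic integers; the index of $g(x)$ is $[\mathbb{Z}_K:\mathbb{Z}[\theta]]$ (it is finite). $g(x)$ is called monogenic if its index equals $1$. Irreducibility is over $\mathbb{Q}$. Note that irreducibility of $f(x^k)$ implies irreducibility of $f(x^t)$ for every divisor $t$ of $k$. *)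

theory Defs
  imports
    "HOL-Algebra.Algebraic_Closure_Type"
    "HOL-Algebra.Generated_Fields"
    "HOL-Computational_Algebra.Computational_Algebra"
begin

text \<open>
  As \<open>\<complex>\<close> has characteristic 0, the subfield generated by \<open>\<theta>\<close> alone contains \<open>\<rat>\<close> and so is \<open>\<rat>(\<theta>)\<close>;
  the unital subring generated by \<open>\<theta>\<close> alone is \<open>\<int>[\<theta>]\<close>.
\<close>

abbreviation complex_ring :: "complex ring" where
  "complex_ring \<equiv> ring_of_type_algebra"

definition rat_adjoin :: "complex \<Rightarrow> complex set" where
  "rat_adjoin \<theta> = generate_field complex_ring {\<theta>}"

definition int_adjoin :: "complex \<Rightarrow> complex set" where
  "int_adjoin \<theta> = generate_ring complex_ring {\<theta>}"

definition ring_of_integers :: "complex set \<Rightarrow> complex set" where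
  "ring_of_integers K = {x \<in> K. algebraic_int x}"

text \<open>
  \<open>[M : N]\<close> for additive groups \<open>N \<le> M \<le> \<complex>\<close>. As \<open>card\<close> is 0 on infinite sets, an infinite
  index would be 0; for the indices used below this case does not arise.
\<close>

definition additive_index :: "complex set \<Rightarrow> complex set \<Rightarrow> nat" where
  "additive_index M N = card (a_rcosets\<^bsub>complex_ring\<lparr>carrier := M\<rparr>\<^esub> N)"

definition irreducible_over_rat :: "int poly \<Rightarrow> bool" where
  "irreducible_over_rat g \<longleftrightarrow> Factorial_Ring.irreducible (map_poly rat_of_int g)"

text \<open>
  The index \<open>[\<int>\<^sub>K : \<int>[\<theta>]]\<close> of a monic irreducible \<open>g\<close>, with \<open>\<theta>\<close> a complex root of \<open>g\<close> and
  \<open>K = \<rat>(\<theta>)\<close>. All roots of \<open>g\<close> are conjugate, so the value does not depend on the one selected.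
\<close>

definition poly_index :: "int poly \<Rightarrow> nat" where
  "poly_index g =
     (let \<theta> = (SOME z :: complex. poly (map_poly of_int g) z = 0)
      in additive_index (ring_of_integers (rat_adjoin \<theta>)) (int_adjoin \<theta>))"

definition monogenic :: "int poly \<Rightarrow> bool" where
  "monogenic g \<longleftrightarrow>
     Polynomial.lead_coeff g = 1 \<and> irreducible_over_rat g \<and> poly_index g = 1"

text \<open>\<open>f(x^k)\<close>\<close>

definition subst_power :: "int poly \<Rightarrow> nat \<Rightarrow> int poly" where
  "subst_power f k = pcompose f (Polynomial.monom 1 k)"

end

theory Submission
  imports Defs "Jordan_Normal_Form.Char_Poly"
begin

text \<open>
  The proof rests on Uchida's criterion: for a monic irreducible \<open>g\<close> with root \<open>\<theta>\<close>, the order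
  \<open>\<int>[\<theta>]\<close> is maximal iff \<open>g\<close> lies in the square of no maximal ideal \<open>(p, \<phi>)\<close> of \<open>\<int>[x]\<close>.
  If \<open>f(x\<^sup>t)\<close> lies in \<open>(p, \<phi>)\<^sup>2\<close> for a divisor \<open>t\<close> of \<open>k\<close>, then \<open>f(x\<^sup>k)\<close> lies in
  \<open>(p, \<phi>(x\<^bsup>k/t\<^esup>))\<^sup>2\<close>, and if \<open>p\<^sup>2\<close> divides \<open>f(0)\<close>, then \<open>f(x\<^sup>k)\<close> lies in \<open>(p, x)\<^sup>2\<close>, since \<open>k \<ge> 2\<close>.
  Conversely let \<open>f(x\<^sup>k)\<close> lie in \<open>m\<^sup>2\<close> with \<open>m = (p, \<phi>)\<close> maximal; as \<open>f(0)\<close> is squarefree, \<open>x\<close> is not in \<open>m\<close>.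
  Write \<open>k = p\<^sup>s l\<close> with \<open>p\<close> not dividing \<open>l\<close>. The substitution \<open>x \<mapsto> x\<^sup>p\<close> lifts the Frobenius
  map modulo \<open>p\<close>, which makes it possible to replace \<open>s\<close> by \<open>min s 1\<close>. The substitution \<open>x \<mapsto> x\<^sup>l\<close> is unramified
  at \<open>m\<close>, so that the contraction \<open>n\<close> of \<open>m\<close> along it satisfies \<open>f \<in> n\<^sup>2\<close> or \<open>f(x\<^sup>p) \<in> n\<^sup>2\<close>.
\<close>

section \<open>Ideals of integer polynomials generated by a prime and a monic polynomial\<close>

definition pair_ideal :: "nat \<Rightarrow> int poly \<Rightarrow> int poly set" where
  "pair_ideal p \<phi> = {of_nat p * a + \<phi> * b | a b. True}"

text \<open>The square of the ideal (p, \<phi>), written on three generators so that membership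
  hands over explicit cofactors.\<close>

definition pair_ideal_sq :: "nat \<Rightarrow> int poly \<Rightarrow> int poly set" where
  "pair_ideal_sq p \<phi> = {of_nat p ^ 2 * a + of_nat p * \<phi> * b + \<phi> ^ 2 * c | a b c. True}"

lemma of_nat_dvd_poly_iff: "of_nat p dvd (P :: int poly) \<longleftrightarrow> (\<forall>i. int p dvd coeff P i)"
  by (simp add: of_nat_poly const_poly_dvd_iff)

lemma prime_elem_of_nat_poly:
  "prime p \<Longrightarrow> prime_elem (of_nat p :: int poly)"
  by (simp add: of_nat_poly lift_prime_elem_poly)

lemma not_of_nat_dvd_monic:
  assumes "prime p" "monic (P :: int poly)"
  shows "\<not> of_nat p dvd P"
proof
  assume "of_nat p dvd P"
  then have "int p dvd 1"
    using assms(2) by (metis of_nat_dvd_poly_iff)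
  then show False
    using assms(1) not_prime_1 by auto
qed

lemma monic_division:
  fixes \<phi> a :: "int poly"
  assumes "monic \<phi>"
  obtains s r where "a = \<phi> * s + r" "r = 0 \<or> degree r < degree \<phi>"
proof -
  obtain s r where *: "pseudo_divmod a \<phi> = (s, r)"
    by fastforce
  have "\<phi> \<noteq> 0"
    using assms by auto
  from pseudo_divmod[OF this *] assms show thesis
    by (intro that[of s r]) simp_all
qed

text \<open>Leading terms divisible by p are dropped until the leading coefficient is a unit modulo
  p; an inverse modulo p then makes it 1. Euclidean arguments over the field with p elements can
  thus be run with monic polynomials in \<int>[x].\<close>

lemma monic_mod_prime:
  fixes r :: "int poly"
  assumes "prime p" "\<not> of_nat p dvd r"
  shows "\<exists>c u t. t = c * r + of_nat p * u \<and> monic t \<and> degree t \<le> degree r"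
  using assms(2)
proof (induction "degree r" arbitrary: r rule: less_induct)
  case less
  define d where "d = degree r"
  define l where "l = lead_coeff r"
  show ?case
  proof (cases "int p dvd l")
    case False
    have "coprime l (int p)"
      using assms(1) False by (metis coprime_commute prime_imp_coprime prime_nat_int_transfer)
    then obtain c e where ce: "c * l + e * int p = 1"
      by (metis bezout_int coprime_imp_gcd_eq_1)
    \<comment> \<open>The leading coefficient of \<open>[:c:] * r\<close> is 1 only modulo p; the
      added monomial corrects it to \<open>c * l + e * int p\<close>, which is exactly 1.\<close>
    define t where "t = [:c:] * r + of_nat p * monom e d"
    have co: "coeff t i = c * coeff r i + (if i = d then int p * e else 0)" for i
      by (simp add: t_def of_nat_poly)
    have t: "coeff t d = 1"
      using ce unfolding co by (simp add: l_def d_def algebra_simps)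
    have dt: "degree t \<le> d"
      by (rule degree_le) (simp add: co coeff_eq_0 d_def)
    then have "degree t = d"
      using t by (intro antisym le_degree) auto
    then have "monic t" "degree t \<le> degree r"
      using t by (simp_all add: d_def)
    then show ?thesis
      using t_def by (intro exI[of _ "[:c:]"] exI[of _ "monom e d"] exI[of _ t] conjI)
  next
    case True
    define r' where "r' = r - monom l d"
    have dv: "of_nat p dvd monom l d"
      using True unfolding of_nat_dvd_poly_iff by (simp add: coeff_monom)
    then have nd: "\<not> of_nat p dvd r'"
      using less.prems dvd_add[of "of_nat p" r' "monom l d"] unfolding r'_def by auto
    have "degree r' < d"
    proof -
      have "degree r' \<le> d"
        by (rule degree_le) (simp add: r'_def coeff_eq_0 d_def)
      moreover have "coeff r' d = 0"
        by (simp add: r'_def l_def d_def)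
      moreover have "r' \<noteq> 0"
        using nd by auto
      ultimately show ?thesis
        by (metis le_neq_implies_less leading_coeff_0_iff)
    qed
    then obtain c u t where t: "t = c * r' + of_nat p * u" "monic t" "degree t \<le> degree r'"
      using less.hyps[of r'] nd unfolding d_def by blast
    obtain v where v: "monom l d = of_nat p * v"
      using dv by blast
    have t_eq: "t = c * r + of_nat p * (u - c * v)"
      unfolding t(1) r'_def v by (simp add: algebra_simps)
    have "degree t \<le> degree r"
      using t(3) \<open>degree r' < d\<close> unfolding d_def by linarith
    then show ?thesis
      using t(2) t_eq by (intro exI[of _ c] exI[of _ "u - c * v"] exI[of _ t] conjI)
  qed
qed

text \<open>Polynomials over the field with p elements form a principal ideal ring, and this is
  lifted to \<int>[x]. A monic member \<open>t\<close> of least degree generates \<open>J\<close>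
  together with p: a remainder of division by \<open>t\<close> lies in \<open>J\<close>, and if it
  were nonzero modulo p, it would yield a monic member of smaller degree. The member
  \<open>g\<close> ensures that \<open>t\<close> exists.\<close>

lemma ideal_eq_pair_ideal:
  fixes J :: "int poly set"
  assumes p: "prime p" "of_nat p \<in> J"
    and J: "\<And>a b. a \<in> J \<Longrightarrow> b \<in> J \<Longrightarrow> a + b \<in> J" "\<And>a c. a \<in> J \<Longrightarrow> c * a \<in> J" "1 \<notin> J"
    and g: "g \<in> J" "monic g"
  obtains t where "monic t" "degree t > 0" "J = pair_ideal p t"
    "\<And>r. r \<in> J \<Longrightarrow> r = 0 \<or> degree r < degree t \<Longrightarrow> of_nat p dvd r"
proof -
  define t where "t = arg_min degree (\<lambda>t. t \<in> J \<and> monic t)"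
  have t: "t \<in> J" "monic t" and min: "\<And>s. s \<in> J \<Longrightarrow> monic s \<Longrightarrow> degree t \<le> degree s"
    using arg_min_nat_lemma[of "\<lambda>t. t \<in> J \<and> monic t" g degree] g
    unfolding t_def by blast+
  have small: "of_nat p dvd r" if "r \<in> J" "r = 0 \<or> degree r < degree t" for r
  proof (rule ccontr)
    assume nd: "\<not> of_nat p dvd r"
    then obtain c u s where s: "s = c * r + of_nat p * u" "monic s" "degree s \<le> degree r"
      using monic_mod_prime[OF p(1)] by blast
    have "s \<in> J"
      unfolding s(1) using J(1,2) p(2) that(1) by (metis mult.commute)
    then show False
      using min[of s] s that(2) nd by auto
  qed
  have "J = pair_ideal p t"
  proof (intro equalityI subsetI)
    fix a assume a: "a \<in> J"
    obtain s r where sr: "a = t * s + r" "r = 0 \<or> degree r < degree t"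
      using monic_division[OF t(2)] by blast
    have "r = a + (- s) * t"
      by (simp add: sr(1))
    then have "r \<in> J"
      using J(1,2) a t(1) by metis
    then obtain v where "r = of_nat p * v"
      using small[of r] sr(2) by blast
    then show "a \<in> pair_ideal p t"
      unfolding pair_ideal_def sr(1) by (auto simp: add.commute)
  next
    fix a assume "a \<in> pair_ideal p t"
    then obtain u v where "a = of_nat p * u + t * v"
      unfolding pair_ideal_def by blast
    then show "a \<in> J"
      using J(1)[OF J(2)[OF p(2)] J(2)[OF t(1)], of u v] by (simp add: mult.commute)
  qed
  moreover have "degree t > 0"
  proof (rule ccontr)
    assume "\<not> degree t > 0"
    then have "t = 1"
      using t(2) monic_degree_0 by blast
    then show False
      using t(1) J(3) by simp
  qed
  ultimately show thesis
    using that t(2) small by blast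
qed

section \<open>Arithmetic of the ideal (p, \<phi>) and of its square\<close>

lemma pair_ideal_add:
  assumes "x \<in> pair_ideal p \<phi>" "y \<in> pair_ideal p \<phi>"
  shows "x + y \<in> pair_ideal p \<phi>"
proof -
  obtain a b where x: "x = of_nat p * a + \<phi> * b"
    using assms(1) unfolding pair_ideal_def by blast
  obtain a' b' where y: "y = of_nat p * a' + \<phi> * b'"
    using assms(2) unfolding pair_ideal_def by blast
  have "x + y = of_nat p * (a + a') + \<phi> * (b + b')"
    unfolding x y by (simp add: algebra_simps)
  then show ?thesis
    unfolding pair_ideal_def by blast
qed

lemma pair_ideal_mult: "a \<in> pair_ideal p \<phi> \<Longrightarrow> c * a \<in> pair_ideal p \<phi>"
  unfolding pair_ideal_def by clarsimp (metis distrib_left mult.left_commute)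

lemma pair_ideal_mult_right: "a \<in> pair_ideal p \<phi> \<Longrightarrow> a * c \<in> pair_ideal p \<phi>"
  using pair_ideal_mult[of a p \<phi> c] by (simp add: mult.commute)

lemma pair_ideal_minus: "a \<in> pair_ideal p \<phi> \<Longrightarrow> - a \<in> pair_ideal p \<phi>"
  using pair_ideal_mult[of a p \<phi> "-1"] by simp

lemma pair_ideal_diff: "a \<in> pair_ideal p \<phi> \<Longrightarrow> b \<in> pair_ideal p \<phi> \<Longrightarrow> a - b \<in> pair_ideal p \<phi>"
  using pair_ideal_add[of a p \<phi> "- b"] pair_ideal_minus[of b] by simp

lemma pair_ideal_of_nat: "of_nat p \<in> pair_ideal p \<phi>"
  unfolding pair_ideal_def by (intro CollectI exI[of _ 1] exI[of _ 0]) simp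

lemma pair_ideal_generator: "\<phi> \<in> pair_ideal p \<phi>"
  unfolding pair_ideal_def by (intro CollectI exI[of _ 0] exI[of _ 1]) simp

lemma pair_ideal_dvd: "of_nat p dvd a \<Longrightarrow> a \<in> pair_ideal p \<phi>"
  using pair_ideal_mult_right[OF pair_ideal_of_nat] by (auto elim!: dvdE)

lemma pair_ideal_sq_subset: "pair_ideal_sq p \<phi> \<subseteq> pair_ideal p \<phi>"
proof
  fix x assume "x \<in> pair_ideal_sq p \<phi>"
  then obtain a b c where "x = of_nat p ^ 2 * a + of_nat p * \<phi> * b + \<phi> ^ 2 * c"
    unfolding pair_ideal_sq_def by blast
  then have "x = of_nat p * (of_nat p * a + \<phi> * b) + \<phi> * (\<phi> * c)"
    by (simp add: algebra_simps power2_eq_square)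
  then show "x \<in> pair_ideal p \<phi>"
    unfolding pair_ideal_def by blast
qed

lemma pair_ideal_sq_add:
  assumes "x \<in> pair_ideal_sq p \<phi>" "y \<in> pair_ideal_sq p \<phi>"
  shows "x + y \<in> pair_ideal_sq p \<phi>"
proof -
  obtain a b c where x: "x = of_nat p ^ 2 * a + of_nat p * \<phi> * b + \<phi> ^ 2 * c"
    using assms(1) unfolding pair_ideal_sq_def by blast
  obtain a' b' c' where y: "y = of_nat p ^ 2 * a' + of_nat p * \<phi> * b' + \<phi> ^ 2 * c'"
    using assms(2) unfolding pair_ideal_sq_def by blast
  have "x + y = of_nat p ^ 2 * (a + a') + of_nat p * \<phi> * (b + b') + \<phi> ^ 2 * (c + c')"
    unfolding x y by (simp add: algebra_simps)
  then show ?thesis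
    unfolding pair_ideal_sq_def by blast
qed

lemma pair_ideal_sq_mult:
  assumes "x \<in> pair_ideal_sq p \<phi>"
  shows "d * x \<in> pair_ideal_sq p \<phi>"
proof -
  obtain a b c where x: "x = of_nat p ^ 2 * a + of_nat p * \<phi> * b + \<phi> ^ 2 * c"
    using assms(1) unfolding pair_ideal_sq_def by blast
  have "d * x = of_nat p ^ 2 * (d * a) + of_nat p * \<phi> * (d * b) + \<phi> ^ 2 * (d * c)"
    unfolding x by (simp add: algebra_simps)
  then show ?thesis
    unfolding pair_ideal_sq_def by blast
qed

lemma pair_ideal_sq_diff:
  "x \<in> pair_ideal_sq p \<phi> \<Longrightarrow> y \<in> pair_ideal_sq p \<phi> \<Longrightarrow> x - y \<in> pair_ideal_sq p \<phi>"
  using pair_ideal_sq_add[of x p \<phi> "- 1 * y"] pair_ideal_sq_mult[of y p \<phi> "- 1"] by simp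

lemma pair_ideal_sq_times:
  assumes "x \<in> pair_ideal p \<phi>" "y \<in> pair_ideal p \<phi>"
  shows "x * y \<in> pair_ideal_sq p \<phi>"
proof -
  obtain a b where x: "x = of_nat p * a + \<phi> * b"
    using assms(1) unfolding pair_ideal_def by blast
  obtain a' b' where y: "y = of_nat p * a' + \<phi> * b'"
    using assms(2) unfolding pair_ideal_def by blast
  have "x * y = of_nat p ^ 2 * (a * a') + of_nat p * \<phi> * (a * b' + a' * b) + \<phi> ^ 2 * (b * b')"
    unfolding x y by (simp add: algebra_simps power2_eq_square)
  then show ?thesis
    unfolding pair_ideal_sq_def by blast
qed

text \<open>Reducing the cofactor of p modulo \<phi> turns a representation of 1 into
  \<open>1 - of_nat p * r = \<phi> * e\<close> with a left side of degree below that of \<phi>. So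
  \<open>e\<close> vanishes and p would divide 1.\<close>

lemma one_notin_pair_ideal:
  assumes "prime p" "monic \<phi>" "degree \<phi> > 0"
  shows "1 \<notin> pair_ideal p \<phi>"
proof
  assume "1 \<in> pair_ideal p \<phi>"
  then obtain a b where ab: "1 = of_nat p * a + \<phi> * b"
    unfolding pair_ideal_def by blast
  obtain s r where sr: "a = \<phi> * s + r" "r = 0 \<or> degree r < degree \<phi>"
    using monic_division[OF assms(2)] by blast
  define e where "e = b + of_nat p * s"
  have eq: "1 - of_nat p * r = \<phi> * e"
    using ab unfolding sr(1) e_def by (simp add: algebra_simps)
  have "degree (1 - of_nat p * r) < degree \<phi>"
  proof (rule le_less_trans[OF degree_diff_le_max])
    have "degree (of_nat p * r) \<le> degree r"
      by (simp add: of_nat_poly)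
    then show "max (degree (1::int poly)) (degree (of_nat p * r)) < degree \<phi>"
      using sr(2) assms(3) by auto
  qed
  then have "e = 0"
    using assms(2,3) unfolding eq
    by (metis add_less_same_cancel1 degree_0 degree_mult_eq not_less0 not_less_zero)
  then have "of_nat p dvd (1 :: int poly)"
    using eq by (intro dvdI[of _ _ r]) simp
  then show False
    using prime_elem_of_nat_poly[OF assms(1)] by (simp add: prime_elem_def)
qed

text \<open>As p is prime in \<int>[x] and does not divide the monic \<phi>^2, it divides the
  cofactor of \<phi>^2; then p cancels throughout.\<close>

lemma of_nat_mult_in_pair_ideal_sq:
  assumes "prime p" "monic \<phi>" "of_nat p * c \<in> pair_ideal_sq p \<phi>"
  shows "c \<in> pair_ideal p \<phi>"
proof -
  obtain u v w where eq: "of_nat p * c = of_nat p ^ 2 * u + of_nat p * \<phi> * v + \<phi> ^ 2 * w"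
    using assms(3) unfolding pair_ideal_sq_def by blast
  then have "\<phi> ^ 2 * w = of_nat p * (c - of_nat p * u - \<phi> * v)"
    by (simp add: algebra_simps power2_eq_square)
  then have "of_nat p dvd \<phi> ^ 2 * w"
    by simp
  moreover have "\<not> of_nat p dvd \<phi> ^ 2"
    using assms by (intro not_of_nat_dvd_monic) (auto simp: monic_power)
  ultimately obtain w' where w': "w = of_nat p * w'"
    using prime_elem_dvd_multD[OF prime_elem_of_nat_poly[OF assms(1)]] by blast
  have "of_nat p * c = of_nat p * (of_nat p * u + \<phi> * (v + \<phi> * w'))"
    unfolding eq w' by (simp add: algebra_simps power2_eq_square)
  then have "c = of_nat p * u + \<phi> * (v + \<phi> * w')"
    using assms(1) by (subst (asm) mult_left_cancel) (auto dest: prime_gt_0_nat)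
  then show ?thesis
    unfolding pair_ideal_def by blast
qed

section \<open>Lifting Frobenius and contracting maximal ideals\<close>

lemma freshman_dream_dvd:
  fixes a b :: "'a :: comm_ring_1"
  assumes "prime p"
  shows "of_nat p dvd (a + b) ^ p - (a ^ p + b ^ p)"
proof -
  define f where "f k = of_nat (p choose k) * a ^ k * b ^ (p - k)" for k
  have p: "p > 0"
    using assms by (rule prime_gt_0_nat)
  have "(a + b) ^ p = (\<Sum>k\<le>p. f k)"
    by (simp add: binomial_ring f_def)
  also have "{..p} = insert 0 (insert p {0<..<p})"
    using p by auto
  also have "sum f \<dots> = a ^ p + b ^ p + sum f {0<..<p}"
    using p by (simp add: f_def algebra_simps)
  finally have "(a + b) ^ p - (a ^ p + b ^ p) = sum f {0<..<p}"
    by simp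
  moreover have "of_nat p dvd f k" if "k \<in> {0<..<p}" for k
  proof -
    have "p dvd p choose k"
      using that assms by (intro dvd_choose_prime) auto
    then have "(of_nat p :: 'a) dvd of_nat (p choose k)"
      by (metis dvd_def of_nat_mult)
    then show ?thesis
      unfolding f_def by (simp add: mult.assoc)
  qed
  ultimately show ?thesis
    by (metis dvd_sum)
qed

lemma diff_dvd_power_diff: "x - y dvd x ^ n - (y :: 'a :: comm_ring_1) ^ n"
  by (metis dvd_triv_left power_diff_sumr2)

text \<open>The induction over natural numbers uses that (n + 1)^p and n^p + 1 agree modulo p; an
  arbitrary integer is replaced by its residue.\<close>

lemma fermat_int_dvd:
  assumes "prime p"
  shows "int p dvd a ^ p - a"
proof -
  have nat: "int p dvd int n ^ p - int n" for n
  proof (induction n)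
    case 0
    then show ?case
      using prime_gt_0_nat[OF assms] by (simp add: zero_power)
  next
    case (Suc n)
    have "int p dvd ((int n + 1) ^ p - (int n ^ p + 1 ^ p)) + (int n ^ p - int n)"
      using freshman_dream_dvd[OF assms, of "int n" 1] Suc by (intro dvd_add) simp_all
    then show ?case
      by (simp add: algebra_simps)
  qed
  define n where "n = nat (a mod int p)"
  have n: "int n = a mod int p"
    unfolding n_def using assms by (simp add: prime_gt_0_nat)
  have 1: "int p dvd a - int n"
    unfolding n by (metis dvd_triv_left minus_mod_eq_mult_div)
  then have "int p dvd a ^ p - int n ^ p"
    using diff_dvd_power_diff dvd_trans by blast
  then have "int p dvd (a ^ p - int n ^ p) + (int n ^ p - int n) - (a - int n)"
    by (rule dvd_diff[OF dvd_add[OF _ nat[of n]] 1])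
  then show ?thesis
    by simp
qed

lemma pcompose_monom_monom:
  fixes P :: "int poly"
  shows "pcompose (pcompose P (monom 1 m)) (monom 1 n) = pcompose P (monom 1 (m * n))"
proof -
  have "pcompose (monom (1::int) m) (monom 1 n) = monom 1 (m * n)"
    by (simp add: monom_altdef[of 1 m] pcompose_hom.hom_power pcompose_pCons monom_power mult.commute)
  then show ?thesis
    by (simp flip: pcompose_assoc)
qed

text \<open>Modulo p, raising to the p-th power is additive and fixes the coefficients by Fermat's
  theorem, so it acts only on the variable. The induction follows the Horner form a + x P.\<close>

lemma frobenius_lift_dvd:
  fixes P :: "int poly"
  assumes "prime p"
  shows "of_nat p dvd pcompose P (monom 1 p) - P ^ p"
proof (induction P)
  case 0
  then show ?case
    using prime_gt_0_nat[OF assms] by (simp add: zero_power)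
next
  case (pCons a P)
  define Y where "Y = monom (1 :: int) 1"
  have Y: "Y ^ p = monom 1 p"
    by (simp add: Y_def monom_power)
  have pcompose_Y: "pcompose Y (monom 1 p) = Y ^ p"
    by (simp add: Y_def monom_altdef pcompose_pCons)
  have eq: "pCons a P = [:a:] + Y * P"
    by (simp add: Y_def monom_altdef)
  have 1: "of_nat p dvd ([:a:] + Y * P) ^ p - ([:a:] ^ p + (Y * P) ^ p)"
    using freshman_dream_dvd[OF assms] .
  have 2: "of_nat p dvd [:a:] ^ p - [:a:]"
    using fermat_int_dvd[OF assms, of a]
    by (simp add: of_nat_poly poly_const_pow)
  have 3: "of_nat p dvd Y ^ p * (pcompose P (monom 1 p) - P ^ p)"
    using pCons.IH by (rule dvd_mult)
  have "pcompose (pCons a P) (monom 1 p) - pCons a P ^ p =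
      Y ^ p * (pcompose P (monom 1 p) - P ^ p) - ([:a:] ^ p - [:a:])
      - (([:a:] + Y * P) ^ p - ([:a:] ^ p + (Y * P) ^ p))"
    unfolding eq
    by (simp add: pcompose_add pcompose_mult pcompose_Y power_mult_distrib algebra_simps)
  then show ?case
    using dvd_diff[OF dvd_diff[OF 3 2] 1] by (simp only:)
qed

lemma frobenius_lift_power_dvd:
  fixes P :: "int poly"
  assumes "prime p"
  shows "of_nat p dvd pcompose P (monom 1 (p ^ s)) - P ^ (p ^ s)"
proof (induction s)
  case 0
  then show ?case
    by (simp add: monom_altdef pcompose_idR)
next
  case (Suc s)
  define Q where "Q = pcompose P (monom 1 (p ^ s))"
  have "of_nat p dvd Q ^ p - (P ^ p ^ s) ^ p"
    using Suc diff_dvd_power_diff dvd_trans unfolding Q_def by blast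
  then have "of_nat p dvd (pcompose Q (monom 1 p) - Q ^ p) + (Q ^ p - (P ^ p ^ s) ^ p)"
    using frobenius_lift_dvd[OF assms] by (intro dvd_add)
  then show ?case
    by (simp add: Q_def pcompose_monom_monom power_mult mult.commute flip: power_mult)
qed

text \<open>If p divides i t_i and not i, it divides t_i; so only exponents divisible by p survive
  modulo p, and \<rho> collects their coefficients. The exact coefficient formula is exported
  because it later shows that \<rho> is monic.\<close>

lemma pth_power_mod_prime:
  fixes t :: "int poly"
  assumes p: "prime p" and dv: "of_nat p dvd pderiv t"
  obtains \<rho> where "of_nat p dvd t - pcompose \<rho> (monom 1 p)" "\<And>j. coeff \<rho> j = coeff t (p * j)"
proof -
  have p0: "p > 0"
    using p by (rule prime_gt_0_nat)
  define \<rho> where "\<rho> = (\<Sum>j\<le>degree t. monom (coeff t (p * j)) j)"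
  have co: "coeff \<rho> j = coeff t (p * j)" for j
  proof (cases "j \<le> degree t")
    case True
    then show ?thesis
      by (simp add: \<rho>_def coeff_sum coeff_monom)
  next
    case False
    then have "degree t < p * j"
      using p0 by (metis le_square less_le_trans linorder_not_less mult_le_mono1 nat_mult_1 One_nat_def Suc_leI)
    then show ?thesis
      using False by (simp add: \<rho>_def coeff_sum coeff_monom coeff_eq_0)
  qed
  have "int p dvd coeff (t - pcompose \<rho> (monom 1 p)) i" for i
  proof -
    define j r where "j = i div p" and "r = i mod p"
    have i: "i = p * j + r" and r: "r < p"
      using p0 by (simp_all add: j_def r_def)
    have c: "coeff (pcompose \<rho> (monom 1 p)) i = (if r = 0 then coeff \<rho> j else 0)"
      unfolding i using coeff_pcompose_monom[OF r] .
    show ?thesis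
    proof (cases "r = 0")
      case True
      then show ?thesis
        using c by (simp add: co i)
    next
      case False
      then have "\<not> p dvd i"
        by (simp add: r_def mod_eq_0_iff_dvd)
      then have "\<not> int p dvd int i"
        by simp
      moreover obtain i' where i': "i = Suc i'"
        using False i not0_implies_Suc[of i] by auto
      moreover have "int p dvd int (Suc i') * coeff t (Suc i')"
        using dv by (simp only: of_nat_dvd_poly_iff coeff_pderiv)
      ultimately have "int p dvd coeff t i"
        using p by (metis prime_dvd_mult_iff prime_nat_int_transfer)
      then show ?thesis
        using c False by simp
    qed
  qed
  then show thesis
    using that co unfolding of_nat_dvd_poly_iff by blast
qed

text \<open>By the product rule, the derivative of a product of two members of the ideal keeps one
  of them as a factor in each term.\<close>

lemma pderiv_in_pair_ideal:
  assumes "x \<in> pair_ideal_sq p \<phi>"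
  shows "pderiv x \<in> pair_ideal p \<phi>"
proof -
  obtain a b c where x: "x = of_nat p ^ 2 * a + of_nat p * \<phi> * b + \<phi> ^ 2 * c"
    using assms unfolding pair_ideal_sq_def by blast
  have "pderiv x = of_nat p * (of_nat p * pderiv a + pderiv \<phi> * b + \<phi> * pderiv b)
      + \<phi> * (2 * pderiv \<phi> * c + \<phi> * pderiv c)"
    unfolding x by (simp add: pderiv_add pderiv_mult power2_eq_square algebra_simps)
  then show ?thesis
    unfolding pair_ideal_def by blast
qed

text \<open>Maximality is phrased as invertibility modulo the ideal of everything outside it:
  \<int>[x]/(p, \<phi>) is a field.\<close>

locale maximal_pair =
  fixes p :: nat and \<phi> :: "int poly"
  assumes prime_p: "prime p"
    and monic_phi: "monic \<phi>"
    and degree_phi: "degree \<phi> > 0"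
    and maximal: "h \<notin> pair_ideal p \<phi> \<Longrightarrow> \<exists>x. 1 - h * x \<in> pair_ideal p \<phi>"
begin

abbreviation m :: "int poly set" where "m \<equiv> pair_ideal p \<phi>"
abbreviation m2 :: "int poly set" where "m2 \<equiv> pair_ideal_sq p \<phi>"

lemma one_notin: "1 \<notin> m"
  using one_notin_pair_ideal prime_p monic_phi degree_phi .

lemma prime_ideal:
  assumes "a * b \<in> m" "a \<notin> m"
  shows "b \<in> m"
proof -
  obtain x where "1 - a * x \<in> m"
    using maximal assms(2) by blast
  then have "b * (1 - a * x) + x * (a * b) \<in> m"
    by (intro pair_ideal_add pair_ideal_mult[OF assms(1)] pair_ideal_mult)
  moreover have "b * (1 - a * x) + x * (a * b) = b"
    by (simp add: algebra_simps)
  ultimately show ?thesis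
    by simp
qed

lemma power_in: "a ^ n \<in> m \<Longrightarrow> a \<in> m"
  by (induction n) (auto simp: one_notin dest: prime_ideal)

lemma power_in_iff: "n > 0 \<Longrightarrow> a ^ n \<in> m \<longleftrightarrow> a \<in> m"
  using power_in pair_ideal_mult_right[of a p \<phi> "a ^ (n - 1)"]
  by (metis power_minus_mult mult.commute)

text \<open>The square of a maximal ideal is primary. With \<open>x\<close> an inverse of
  \<open>b\<close> modulo \<open>m\<close>, write \<open>a\<close> as
  \<open>x * (a * b) + a * (1 - b * x)\<close>; both factors of the last product lie in
  \<open>m\<close>.\<close>

lemma square_cancel:
  assumes "a * b \<in> m2" "b \<notin> m"
  shows "a \<in> m2"
proof -
  have a: "a \<in> m"
    using assms pair_ideal_sq_subset prime_ideal[of b a] by (auto simp: mult.commute)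
  obtain x where "1 - b * x \<in> m"
    using maximal assms(2) by blast
  then have "x * (a * b) + a * (1 - b * x) \<in> m2"
    by (intro pair_ideal_sq_add pair_ideal_sq_mult[OF assms(1)] pair_ideal_sq_times[OF a])
  moreover have "x * (a * b) + a * (1 - b * x) = a"
    by (simp add: algebra_simps)
  ultimately show ?thesis
    by simp
qed

lemma of_nat_in_iff: "of_nat n \<in> m \<longleftrightarrow> p dvd n"
proof
  assume n: "of_nat n \<in> m"
  show "p dvd n"
  proof (rule ccontr)
    assume "\<not> p dvd n"
    then have "coprime (int n) (int p)"
      using prime_p by (metis coprime_commute coprime_int_iff prime_imp_coprime_nat)
    then obtain c e where ce: "c * int n + e * int p = 1"
      by (metis bezout_int coprime_imp_gcd_eq_1)
    have "of_int c * of_nat n + of_int e * of_nat p \<in> m"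
      using n pair_ideal_of_nat by (intro pair_ideal_add pair_ideal_mult)
    moreover have "of_int c * of_nat n + of_int e * of_nat p = (of_int (c * int n + e * int p) :: int poly)"
      by simp
    ultimately show False
      using one_notin unfolding ce by simp
  qed
next
  assume "p dvd n"
  then show "of_nat n \<in> m"
    by (metis dvd_def of_nat_mult pair_ideal_of_nat pair_ideal_mult_right)
qed

text \<open>Modulo p the substitution is a power map and \<open>m\<close> is a radical ideal, so the
  contraction of \<open>m\<close> along it is \<open>m\<close> itself.\<close>

lemma frobenius_lift_in_iff: "pcompose P (monom 1 (p ^ s)) \<in> m \<longleftrightarrow> P \<in> m"
proof -
  have d: "pcompose P (monom 1 (p ^ s)) - P ^ (p ^ s) \<in> m"
    using frobenius_lift_power_dvd[OF prime_p] by (rule pair_ideal_dvd)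
  have "pcompose P (monom 1 (p ^ s)) \<in> m \<longleftrightarrow> P ^ (p ^ s) \<in> m"
    using pair_ideal_diff[OF _ d] pair_ideal_add[OF _ d] by fastforce
  then show ?thesis
    using prime_p by (simp add: power_in_iff prime_gt_0_nat)
qed

lemma power_p_in_square:
  assumes "a \<in> m"
  shows "a ^ p \<in> m2"
proof -
  have "a ^ p = a ^ (p - 2) * (a * a)"
    using prime_ge_2_nat[OF prime_p] by (metis le_add_diff_inverse2 power2_eq_square power_add)
  then show ?thesis
    using assms by (simp add: pair_ideal_sq_mult pair_ideal_sq_times)
qed

text \<open>Write F(x^p) = F^p + p D. Substituting x^(p^r) preserves this shape, and the p-th powers
  lie in \<open>m2\<close> because F lies in \<open>m\<close>. Membership in \<open>m2\<close>
  therefore amounts to D being in \<open>m\<close>, whatever r is.\<close>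

lemma frobenius_descent:
  assumes "pcompose F (monom 1 (p ^ Suc r)) \<in> m2"
  shows "pcompose F (monom 1 p) \<in> m2"
proof -
  obtain D where D: "pcompose F (monom 1 p) = F ^ p + of_nat p * D"
    using frobenius_lift_dvd[OF prime_p, of F] by (metis add_diff_cancel_left' diff_add_cancel add.commute dvd_def)
  let ?F = "pcompose F (monom 1 (p ^ r))"
  have eq: "pcompose F (monom 1 (p ^ Suc r)) = ?F ^ p + of_nat p * pcompose D (monom 1 (p ^ r))"
  proof -
    have "pcompose F (monom 1 (p ^ Suc r)) = pcompose (pcompose F (monom 1 p)) (monom 1 (p ^ r))"
      by (simp add: pcompose_monom_monom)
    also have "\<dots> = ?F ^ p + of_nat p * pcompose D (monom 1 (p ^ r))"
      unfolding D by (simp add: pcompose_add pcompose_mult pcompose_hom.hom_power of_nat_poly pcompose_smult)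
    finally show ?thesis .
  qed
  have F: "F \<in> m"
    using assms pair_ideal_sq_subset frobenius_lift_in_iff by blast
  then have "?F ^ p \<in> m2"
    by (intro power_p_in_square) (simp add: frobenius_lift_in_iff)
  then have "of_nat p * pcompose D (monom 1 (p ^ r)) \<in> m2"
    using pair_ideal_sq_diff[OF assms] unfolding eq by fastforce
  then have "D \<in> m"
    using of_nat_mult_in_pair_ideal_sq[OF prime_p monic_phi] frobenius_lift_in_iff by blast
  then show ?thesis
    unfolding D using F
    by (intro pair_ideal_sq_add power_p_in_square pair_ideal_sq_times pair_ideal_of_nat)
qed

text \<open>The contraction \<open>n\<close> of \<open>m\<close> along x \<mapsto> x^k is again of
  the form (p, t). Since x is not in \<open>m\<close> and p does not divide k, the derivative k
  x^(k-1) is a unit modulo \<open>m\<close>, so the derivative of \<open>G\<close> lies in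
  \<open>n\<close> too. As t is separable modulo p, this forces both cofactors of \<open>G\<close>
  into \<open>n\<close>.\<close>

lemma contraction:
  assumes x: "monom 1 1 \<notin> m" and k: "\<not> p dvd k"
    and G: "monic G" "pcompose G (monom 1 k) \<in> m2"
  obtains \<psi> where "monic \<psi>" "degree \<psi> > 0" "G \<in> pair_ideal_sq p \<psi>"
proof -
  define n where "n = {P. pcompose P (monom 1 k) \<in> m}"
  have k0: "k > 0"
    using k by (intro gr0I) auto
  have G_n: "G \<in> n"
    using G(2) pair_ideal_sq_subset by (auto simp: n_def)
  have one: "1 \<notin> n"
    using one_notin by (simp add: n_def pcompose_1)
  have p_n: "of_nat p \<in> n"
    using pair_ideal_of_nat[of p \<phi>] by (simp add: n_def of_nat_poly)
  have add: "a + b \<in> n" if "a \<in> n" "b \<in> n" for a b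
    using that by (simp add: n_def pcompose_add pair_ideal_add)
  have mult: "c * a \<in> n" if "a \<in> n" for a c
    using that by (simp add: n_def pcompose_mult pair_ideal_mult)
  have diff: "a - b \<in> n" if "a \<in> n" "b \<in> n" for a b
    using that by (simp add: n_def pcompose_diff pair_ideal_diff)
  have prime_n: "b \<in> n" if "a * b \<in> n" "a \<notin> n" for a b
    using that prime_ideal by (simp add: n_def pcompose_mult)
  have pow: "a \<in> n" if "a ^ i \<in> n" for a i
    using that power_in by (simp add: n_def pcompose_hom.hom_power)
  have p_mult: "of_nat p * a \<in> n" for a
    using mult[OF p_n, of a] by (simp add: mult.commute)
  obtain t where t: "monic t" "degree t > 0" "n = pair_ideal p t"
    and small: "\<And>r. r \<in> n \<Longrightarrow> r = 0 \<or> degree r < degree t \<Longrightarrow> of_nat p dvd r"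
    using ideal_eq_pair_ideal[OF prime_p p_n add mult one G_n G(1)] by metis
  \<comment> \<open>Otherwise the derivative vanishes modulo p by its degree, so t is congruent to
    \<rho>^p. Then \<rho> is a monic member of \<open>n\<close> of degree \<open>degree t\<close> /
    p, which contradicts \<open>small\<close>.\<close>
  have deriv_t: "pderiv t \<notin> n"
  proof
    assume "pderiv t \<in> n"
    then have "of_nat p dvd pderiv t"
      using t(2) by (intro small) (auto simp: degree_pderiv)
    then obtain \<rho> where \<rho>: "of_nat p dvd t - pcompose \<rho> (monom 1 p)"
      and co: "\<And>j. coeff \<rho> j = coeff t (p * j)"
      using pth_power_mod_prime[OF prime_p] by blast
    obtain u where u: "t - pcompose \<rho> (monom 1 p) = of_nat p * u"
      using \<rho> by blast
    obtain v where v: "pcompose \<rho> (monom 1 p) - \<rho> ^ p = of_nat p * v"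
      using frobenius_lift_dvd[OF prime_p] by blast
    have "\<rho> ^ p = t - of_nat p * (u + v)"
      using u v by (simp add: algebra_simps)
    moreover have "t \<in> n"
      using pair_ideal_generator unfolding t(3) .
    ultimately have "\<rho> \<in> n"
      using diff p_mult pow by metis
    have p1: "p > 1"
      using prime_gt_1_nat[OF prime_p] .
    have "\<not> int p dvd 1"
      using p1 by simp
    \<comment> \<open>The coefficient 1 of t at its degree survives modulo p in \<rho>(x^p), whose
      exponents are multiples of p; hence p divides \<open>degree t\<close>.\<close>
    then have lt: "int p dvd coeff (pcompose \<rho> (monom 1 p)) (degree t) \<Longrightarrow> False"
      using \<rho> t(1) unfolding of_nat_dvd_poly_iff by (metis coeff_diff dvd_diff_left_iff)
    have "degree t mod p = 0"
    proof (rule ccontr)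
      assume "degree t mod p \<noteq> 0"
      then have "coeff (pcompose \<rho> (monom 1 p)) (p * (degree t div p) + degree t mod p) = 0"
        using p1 by (subst coeff_pcompose_monom) auto
      then show False
        using lt by simp
    qed
    then obtain j where j: "degree t = p * j"
      by auto
    have jt: "j < degree t"
      using j t(2) p1 by simp
    have "coeff \<rho> j = 1"
      using t(1) by (simp add: co j)
    moreover have "coeff \<rho> i = 0" if "i > j" for i
      using that p1 by (simp add: co coeff_eq_0 j)
    ultimately have "degree \<rho> = j"
      by (metis degree_le le_antisym le_degree zero_neq_one)
    then have "of_nat p dvd \<rho>" "monic \<rho>"
      using small[OF \<open>\<rho> \<in> n\<close>] jt \<open>coeff \<rho> j = 1\<close> by auto
    then show False
      using not_of_nat_dvd_monic[OF prime_p] by blast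
  qed
  have G'_n: "pderiv G \<in> n"
  proof -
    have "pderiv (pcompose G (monom 1 k)) \<in> m"
      using pderiv_in_pair_ideal G(2) .
    also have "pderiv (pcompose G (monom 1 k)) =
        (of_nat k * monom 1 1 ^ (k - 1)) * pcompose (pderiv G) (monom 1 k)"
      by (simp add: pderiv_pcompose pderiv_monom monom_power of_nat_poly smult_monom)
    finally have *: "\<dots> \<in> m" .
    have "of_nat k \<notin> m"
      using k of_nat_in_iff by blast
    then have "of_nat k * monom 1 1 ^ (k - 1) \<notin> m"
      using x power_in prime_ideal by blast
    then show ?thesis
      using prime_ideal[OF *] by (simp add: n_def)
  qed
  obtain b a where G_eq: "G = of_nat p * b + t * a"
    using G_n unfolding t(3) pair_ideal_def by blast
  \<comment> \<open>In the derivative of \<open>G\<close> every term other than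
    \<open>pderiv t * a\<close> has a factor p or t, hence lies in \<open>n\<close>.\<close>
  have "pderiv t * a = pderiv G - of_nat p * pderiv b - pderiv a * t"
    unfolding G_eq by (simp add: pderiv_add pderiv_mult algebra_simps)
  moreover have t_n: "t \<in> n"
    using pair_ideal_generator unfolding t(3) .
  ultimately have "pderiv t * a \<in> n"
    using G'_n diff p_mult mult by metis
  then have "a \<in> n"
    using prime_n deriv_t by blast
  then have ta: "t * a \<in> pair_ideal_sq p t"
    using t_n unfolding t(3) by (intro pair_ideal_sq_times)
  \<comment> \<open>Now that \<open>a\<close> is in \<open>n\<close>, the product t a maps into
    \<open>m2\<close>; what remains of \<open>G\<close> is p b, and cancelling p puts b into
    \<open>n\<close>.\<close>
  have "pcompose t (monom 1 k) * pcompose a (monom 1 k) \<in> m2"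
    using t_n \<open>a \<in> n\<close> by (intro pair_ideal_sq_times) (simp_all add: n_def)
  then have "pcompose G (monom 1 k) - pcompose t (monom 1 k) * pcompose a (monom 1 k) \<in> m2"
    using G(2) by (intro pair_ideal_sq_diff)
  then have "of_nat p * pcompose b (monom 1 k) \<in> m2"
    unfolding G_eq by (simp add: pcompose_add pcompose_mult of_nat_poly pcompose_smult)
  then have "b \<in> n"
    using of_nat_mult_in_pair_ideal_sq[OF prime_p monic_phi] by (simp add: n_def)
  then have "of_nat p * b \<in> pair_ideal_sq p t"
    unfolding t(3) by (intro pair_ideal_sq_times pair_ideal_of_nat)
  then have "G \<in> pair_ideal_sq p t"
    unfolding G_eq using ta by (rule pair_ideal_sq_add)
  then show thesis
    using that t(1,2) by blast
qed

end

section \<open>Algebraic integers\<close>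

interpretation int_span: Modules.module "\<lambda>(n :: int) (x :: complex). of_int n * x"
  by unfold_locales (simp_all add: algebra_simps)

text \<open>The vector \<open>v\<close> is a nonzero eigenvector of an integer matrix for the
  eigenvalue \<open>z\<close>, so \<open>z\<close> is a root of its characteristic polynomial, which
  is monic over \<int>.\<close>

lemma algebraic_int_eigenvalue:
  fixes z :: complex and n :: nat
  assumes eq: "\<And>i. i < n \<Longrightarrow> z * v i = (\<Sum>j<n. of_int (a i j) * v j)"
    and nz: "k < n" "v k \<noteq> 0"
  shows "algebraic_int z"
proof -
  define A where "A = mat n n (\<lambda>(i, j). a i j)"
  define B :: "complex mat" where "B = map_mat of_int A"
  have A: "A \<in> carrier_mat n n"
    by (simp add: A_def)
  then have B: "B \<in> carrier_mat n n"
    by (simp add: B_def)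
  have "eigenvector B (vec n v) z"
    unfolding eigenvector_def
  proof (intro conjI)
    show "vec n v \<noteq> 0\<^sub>v (dim_row B)"
    proof
      assume "vec n v = 0\<^sub>v (dim_row B)"
      then have "vec n v $ k = 0\<^sub>v n $ k"
        using B by simp
      then show False
        using nz by simp
    qed
    show "B *\<^sub>v vec n v = z \<cdot>\<^sub>v vec n v"
    proof (rule eq_vecI)
      fix i assume "i < dim_vec (z \<cdot>\<^sub>v vec n v)"
      then have i: "i < n"
        by simp
      have "(B *\<^sub>v vec n v) $ i = (\<Sum>j = 0..<n. of_int (a i j) * v j)"
        using i by (simp add: B_def A_def scalar_prod_def)
      then show "(B *\<^sub>v vec n v) $ i = (z \<cdot>\<^sub>v vec n v) $ i"
        using i eq[OF i] by (simp add: atLeast0LessThan)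
    qed (use B in auto)
  qed (use B in auto)
  then have "poly (char_poly B) z = 0"
    using eigenvalue_root_char_poly[OF B] unfolding eigenvalue_def by blast
  moreover have "char_poly B = of_int_poly (char_poly A)"
    unfolding B_def by (rule of_int_hom.char_poly_hom[OF A])
  ultimately show ?thesis
    unfolding algebraic_int_altdef_ipoly using degree_monic_char_poly[OF A] by metis
qed

text \<open>The multiplier ring of the \<int>-module spanned by \<open>S\<close>. Sums and products
  of algebraic integers are handled by placing both operands in the multiplier ring of one finite
  \<open>S\<close>.\<close>

definition multiplier_ring :: "complex set \<Rightarrow> complex set" where
  "multiplier_ring S = {z. \<forall>x\<in>int_span.span S. z * x \<in> int_span.span S}"

lemma multiplier_ringI:
  assumes "\<And>s. s \<in> S \<Longrightarrow> z * s \<in> int_span.span S"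
  shows "z \<in> multiplier_ring S"
  unfolding multiplier_ring_def
proof (intro CollectI ballI)
  fix x assume "x \<in> int_span.span S"
  then show "z * x \<in> int_span.span S"
  proof (induction rule: int_span.span_induct_alt)
    case base
    then show ?case by (simp add: int_span.span_zero)
  next
    case (step c x y)
    have "z * (of_int c * x + y) = of_int c * (z * x) + z * y"
      by (simp add: algebra_simps)
    then show ?case
      using assms[OF step(1)] step(2) by (simp only: int_span.span_add int_span.span_scale)
  qed
qed

lemma multiplier_ring_add: "x \<in> multiplier_ring S \<Longrightarrow> y \<in> multiplier_ring S \<Longrightarrow> x + y \<in> multiplier_ring S"
  unfolding multiplier_ring_def by (simp add: distrib_right int_span.span_add)

lemma multiplier_ring_mult: "x \<in> multiplier_ring S \<Longrightarrow> y \<in> multiplier_ring S \<Longrightarrow> x * y \<in> multiplier_ring S"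
  unfolding multiplier_ring_def by (simp add: mult.assoc)

lemma multiplier_ring_of_int: "of_int n \<in> multiplier_ring S"
  unfolding multiplier_ring_def by (simp add: int_span.span_scale)

lemma multiplier_ring_poly: "x \<in> multiplier_ring S \<Longrightarrow> poly (of_int_poly P) x \<in> multiplier_ring S"
  by (induction P) (use multiplier_ring_of_int[of 0 S] in
    \<open>simp_all add: Polynomial.map_poly_pCons multiplier_ring_add multiplier_ring_mult multiplier_ring_of_int\<close>)

text \<open>The determinant trick: multiplication by \<open>z\<close> on the generators is given by
  an integer matrix, and the generator 1 makes the eigenvector nonzero.\<close>

lemma algebraic_int_multiplier_ring:
  assumes S: "finite S" "1 \<in> S" and z: "z \<in> multiplier_ring S"
  shows "algebraic_int z"
proof -
  obtain v where v: "bij_betw v {..<card S} S"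
    using ex_bij_betw_nat_finite[OF S(1)] by (auto simp: atLeast0LessThan)
  have "\<forall>s\<in>S. \<exists>u. z * s = (\<Sum>t\<in>S. of_int (u t) * t)"
  proof
    fix s assume "s \<in> S"
    then have "z * s \<in> int_span.span S"
      using z unfolding multiplier_ring_def by (simp add: int_span.span_base)
    then show "\<exists>u. z * s = (\<Sum>t\<in>S. of_int (u t) * t)"
      unfolding int_span.span_finite[OF S(1)] by blast
  qed
  then obtain u where u: "\<And>s. s \<in> S \<Longrightarrow> z * s = (\<Sum>t\<in>S. of_int (u s t) * t)"
    by metis
  obtain k where k: "k < card S" "v k = 1"
    using v S(2) unfolding bij_betw_def by (metis imageE lessThan_iff)
  show ?thesis
  proof (rule algebraic_int_eigenvalue[of "card S" z v "\<lambda>i j. u (v i) (v j)" k])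
    fix i assume "i < card S"
    then have "v i \<in> S"
      using v unfolding bij_betw_def by blast
    then have "z * v i = (\<Sum>t\<in>S. of_int (u (v i) t) * t)"
      by (rule u)
    also have "\<dots> = (\<Sum>j<card S. of_int (u (v i) (v j)) * v j)"
      by (rule sum.reindex_bij_betw[OF v, symmetric])
    finally show "z * v i = (\<Sum>j<card S. of_int (u (v i) (v j)) * v j)" .
  qed (use k in simp_all)
qed

text \<open>The monomials \<open>x\<^sup>i y\<^sup>j\<close> below the two degrees span a module stable under \<open>x\<close> and \<open>y\<close>.\<close>

lemma multiplier_ring_two_generators:
  fixes x y :: complex
  assumes x: "poly (of_int_poly P) x = 0" "monic P"
    and y: "y ^ n = (\<Sum>j<n. poly (of_int_poly (C j)) x * y ^ j)"
  obtains S where "finite S" "1 \<in> S" "x \<in> multiplier_ring S" "y \<in> multiplier_ring S"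
proof -
  define d where "d = degree P"
  define S where "S = (\<lambda>(i, j). x ^ i * y ^ j) ` ({..<d} \<times> {..<n})"
  have "d \<noteq> 0"
  proof
    assume "d = 0"
    then have "P = 1"
      using x(2) monic_degree_0 unfolding d_def by blast
    then show False
      using x(1) by simp
  qed
  moreover have "n \<noteq> 0"
    using y by (intro notI) simp
  ultimately have one: "1 \<in> S"
    unfolding S_def by (intro image_eqI[of _ _ "(0, 0)"]) auto
  have xd: "x ^ d = (\<Sum>i<d. of_int (- coeff P i) * x ^ i)"
  proof -
    have "0 = (\<Sum>i\<le>d. of_int (coeff P i) * x ^ i)"
      using x(1) by (simp add: poly_altdef d_def)
    also have "\<dots> = (\<Sum>i<d. of_int (coeff P i) * x ^ i) + x ^ d"
      using x(2) by (simp add: d_def lessThan_Suc_atMost[symmetric])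
    finally show ?thesis
      by (simp add: sum_negf eq_neg_iff_add_eq_0 add.commute)
  qed
  have base: "x ^ i * y ^ j \<in> int_span.span S" if "i < d" "j < n" for i j
    using that by (intro int_span.span_base) (auto simp: S_def)
  have x_in: "x \<in> multiplier_ring S"
  proof (rule multiplier_ringI)
    fix s assume "s \<in> S"
    then obtain i j where ij: "i < d" "j < n" "s = x ^ i * y ^ j"
      by (auto simp: S_def)
    show "x * s \<in> int_span.span S"
    proof (cases "Suc i < d")
      case True
      then show ?thesis
        using base[of "Suc i" j] ij by (simp add: mult.assoc)
    next
      case False
      then have "d = Suc i"
        using ij(1) by simp
      then have "x * s = x ^ d * y ^ j"
        by (simp add: ij(3))
      also have "\<dots> = (\<Sum>l<d. of_int (- coeff P l) * (x ^ l * y ^ j))"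
        unfolding xd by (simp add: sum_distrib_right mult.assoc)
      also have "\<dots> \<in> int_span.span S"
        using ij(2) by (intro int_span.span_sum int_span.span_scale base) auto
      finally show ?thesis .
    qed
  qed
  have "y \<in> multiplier_ring S"
  proof (rule multiplier_ringI)
    fix s assume "s \<in> S"
    then obtain i j where ij: "i < d" "j < n" "s = x ^ i * y ^ j"
      by (auto simp: S_def)
    show "y * s \<in> int_span.span S"
    proof (cases "Suc j < n")
      case True
      then show ?thesis
        using base[of i "Suc j"] ij by (simp add: algebra_simps)
    next
      case False
      then have "n = Suc j"
        using ij(2) by simp
      then have "y * s = x ^ i * y ^ n"
        by (simp add: ij(3))
      also have "\<dots> = (\<Sum>l<n. poly (of_int_poly (C l)) x * (x ^ i * y ^ l))"
        unfolding y by (simp add: sum_distrib_left algebra_simps)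
      also have "\<dots> \<in> int_span.span S"
      proof (rule int_span.span_sum)
        fix l assume "l \<in> {..<n}"
        then show "poly (of_int_poly (C l)) x * (x ^ i * y ^ l) \<in> int_span.span S"
          using multiplier_ring_poly[OF x_in, of "C l"] base ij(1)
          unfolding multiplier_ring_def by blast
      qed
      finally show ?thesis .
    qed
  qed
  then show thesis
    using that[of S] one x_in by (simp add: S_def)
qed

lemma algebraic_int_multiplier_ring2:
  fixes x y :: complex
  assumes "algebraic_int x" "algebraic_int y"
  obtains S where "finite S" "1 \<in> S" "x \<in> multiplier_ring S" "y \<in> multiplier_ring S"
proof -
  obtain P Q where P: "poly (of_int_poly P) x = 0" "monic P"
    and Q: "poly (of_int_poly Q) y = 0" "monic Q"
    using assms unfolding algebraic_int_altdef_ipoly by blast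
  have const: "poly (of_int_poly [:c:]) x = of_int c" for c
    by (simp add: Polynomial.map_poly_pCons)
  have "0 = (\<Sum>i\<le>degree Q. of_int (coeff Q i) * y ^ i)"
    using Q(1) by (simp add: poly_altdef)
  also have "\<dots> = (\<Sum>i<degree Q. of_int (coeff Q i) * y ^ i) + y ^ degree Q"
    using Q(2) by (simp add: lessThan_Suc_atMost[symmetric])
  finally have "y ^ degree Q = (\<Sum>i<degree Q. poly (of_int_poly [:- coeff Q i:]) x * y ^ i)"
    unfolding const by (simp add: sum_negf eq_neg_iff_add_eq_0 add.commute)
  then show thesis
    using multiplier_ring_two_generators[OF P] that by metis
qed

lemma algebraic_int_plus:
  fixes x y :: complex
  shows "algebraic_int x \<Longrightarrow> algebraic_int y \<Longrightarrow> algebraic_int (x + y)"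
  by (metis algebraic_int_multiplier_ring2 multiplier_ring_add algebraic_int_multiplier_ring)

lemma algebraic_int_times:
  fixes x y :: complex
  shows "algebraic_int x \<Longrightarrow> algebraic_int y \<Longrightarrow> algebraic_int (x * y)"
  by (metis algebraic_int_multiplier_ring2 multiplier_ring_mult algebraic_int_multiplier_ring)

lemma algebraic_int_poly:
  fixes x :: complex
  shows "algebraic_int x \<Longrightarrow> algebraic_int (poly (of_int_poly P) x)"
  by (metis algebraic_int_multiplier_ring2 multiplier_ring_poly algebraic_int_multiplier_ring)

text \<open>Integrality is transitive in this quadratic case: the monomials x^i y^j with j < 2 span
  a module stable under both x and y.\<close>

lemma algebraic_int_quadratic:
  fixes x y :: complex
  assumes "algebraic_int x" "y ^ 2 = poly (of_int_poly B) x * y + poly (of_int_poly C) x"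
  shows "algebraic_int y"
proof -
  obtain P where P: "poly (of_int_poly P) x = 0" "monic P"
    using assms(1) unfolding algebraic_int_altdef_ipoly by blast
  have "y ^ 2 = (\<Sum>j<2. poly (of_int_poly (if j = 0 then C else B)) x * y ^ j)"
    using assms(2) by (simp add: numeral_2_eq_2 lessThan_Suc)
  then show ?thesis
    using multiplier_ring_two_generators[OF P] algebraic_int_multiplier_ring by metis
qed

section \<open>Uchida's criterion\<close>

abbreviation int_eval :: "int poly \<Rightarrow> complex \<Rightarrow> complex" where
  "int_eval P z \<equiv> poly (map_poly of_int P) z"

lemmas int_eval_simps =
  of_int_poly_hom.hom_add of_int_poly_hom.hom_mult of_int_poly_hom.hom_minus of_int_poly_hom.hom_power
  of_int_poly_hom.hom_of_nat of_int_poly_hom.hom_one poly_add poly_mult poly_diff poly_power poly_of_nat poly_1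

locale monic_irreducible_root =
  fixes g :: "int poly" and \<theta> :: complex
  assumes monic_g: "monic g"
    and irreducible_g: "irreducible_over_rat g"
    and root_g: "int_eval g \<theta> = 0"
begin

abbreviation ev :: "int poly \<Rightarrow> complex" where "ev P \<equiv> int_eval P \<theta>"

lemma algebraic_int_theta: "algebraic_int \<theta>"
  using monic_g root_g unfolding algebraic_int_altdef_ipoly by blast

text \<open>\<rat>[x]/(g) is a field: \<open>R\<close> is coprime to the irreducible g, and the
  Bezout identity evaluated at \<theta> inverts \<open>R\<close> there.\<close>

lemma bezout_rat:
  assumes "\<not> map_poly of_int g dvd (R :: rat poly)"
  obtains u where "poly (map_poly of_rat u) \<theta> * poly (map_poly of_rat R) \<theta> = (1 :: complex)"
proof -
  interpret of_rat_poly: map_poly_comm_ring_hom "of_rat :: rat \<Rightarrow> complex" ..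
  let ?g = "map_poly of_int g :: rat poly"
  have "prime_elem ?g"
    using irreducible_g unfolding irreducible_over_rat_def by (rule irreducible_imp_prime_elem_gcd)
  then have "coprime ?g R"
    using assms by (rule prime_elem_imp_coprime)
  then obtain v u where "v * ?g + u * R = 1"
    using bezout_coefficients_fst_snd[of ?g R] by (metis coprime_imp_gcd_eq_1)
  then have "poly (map_poly of_rat (v * ?g + u * R)) \<theta> = (1 :: complex)"
    by simp
  moreover have "poly (map_poly of_rat ?g) \<theta> = 0"
    using root_g by (simp add: map_poly_map_poly o_def)
  ultimately show thesis
    using that[of u] by (simp add: of_rat_poly.hom_add of_rat_poly.hom_mult)
qed

text \<open>Division by the monic g stays within \<int>[x], and a nonzero remainder would be
  invertible at \<theta> by Bezout. So \<int>[\<theta>] is \<int>[x]/(g).\<close>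

lemma dvd_of_ev_eq_0:
  assumes "ev P = 0"
  shows "g dvd P"
proof -
  obtain s r where sr: "P = g * s + r" "r = 0 \<or> degree r < degree g"
    using monic_division[OF monic_g] by blast
  have r0: "ev r = 0"
    using assms root_g unfolding sr(1) by (simp add: int_eval_simps)
  have "r = 0"
  proof (rule ccontr)
    assume nz: "r \<noteq> 0"
    have "\<not> map_poly of_int g dvd (map_poly of_int r :: rat poly)"
    proof
      assume "map_poly of_int g dvd (map_poly of_int r :: rat poly)"
      then have "degree (map_poly of_int g :: rat poly) \<le> degree (map_poly of_int r :: rat poly)"
        using nz by (intro dvd_imp_degree_le) auto
      then show False
        using sr(2) nz by simp
    qed
    then obtain u where "poly (map_poly of_rat u) \<theta> * poly (map_poly of_rat (map_poly of_int r :: rat poly)) \<theta> = (1 :: complex)"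
      using bezout_rat by blast
    then show False
      using r0 by (simp add: map_poly_map_poly o_def)
  qed
  then show ?thesis
    using sr(1) by simp
qed

lemma ev_eq_iff: "ev P = ev Q \<longleftrightarrow> g dvd P - Q"
proof
  assume "ev P = ev Q"
  then show "g dvd P - Q"
    by (intro dvd_of_ev_eq_0) (simp add: int_eval_simps)
next
  assume "g dvd P - Q"
  then obtain h where "P - Q = g * h"
    by blast
  then have "ev (P - Q) = 0"
    using root_g by (simp add: int_eval_simps)
  then show "ev P = ev Q"
    by (simp add: int_eval_simps)
qed

text \<open>
  With \<open>g = p\<^sup>2 u + p \<phi> v + \<phi>\<^sup>2 w\<close>, the element \<open>\<phi>(\<theta>) w(\<theta>) / p\<close> is a root of
  \<open>y\<^sup>2 + v(\<theta>) y + u(\<theta>) w(\<theta>)\<close>.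
\<close>

lemma not_maximal_order_if_in_square:
  assumes p: "prime p" and \<phi>: "monic \<phi>" "degree \<phi> > 0" and g: "g \<in> pair_ideal_sq p \<phi>"
  obtains A where "algebraic_int (ev A / of_nat p)" "ev A / of_nat p \<notin> range ev"
proof -
  obtain u v w where uvw: "g = of_nat p ^ 2 * u + of_nat p * \<phi> * v + \<phi> ^ 2 * w"
    using g unfolding pair_ideal_sq_def by blast
  have p0: "(of_nat p :: complex) \<noteq> 0"
    using p by auto
  define y where "y = ev (\<phi> * w) / of_nat p"
  have "of_nat p ^ 2 * y ^ 2 = of_nat p ^ 2 * (ev (- v) * y + ev (- u * w))"
  proof -
    have "ev (\<phi> ^ 2 * w) = - (of_nat p ^ 2 * ev u + of_nat p * ev \<phi> * ev v)"
      using root_g unfolding uvw by (simp add: int_eval_simps eq_neg_iff_add_eq_0 algebra_simps)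
    then have *: "ev \<phi> ^ 2 * ev w = - (of_nat p ^ 2 * ev u + of_nat p * ev \<phi> * ev v)"
      by (simp add: int_eval_simps)
    have "of_nat p ^ 2 * y ^ 2 = (ev \<phi> ^ 2 * ev w) * ev w"
      using p0 by (simp add: y_def int_eval_simps power2_eq_square algebra_simps)
    also have "\<dots> = of_nat p ^ 2 * (ev (- v) * y + ev (- u * w))"
      unfolding * using p0
      by (simp add: y_def int_eval_simps of_int_poly_hom.hom_uminus power2_eq_square field_simps)
    finally show ?thesis .
  qed
  then have "y ^ 2 = ev (- v) * y + ev (- u * w)"
    using p0 by simp
  then have "algebraic_int y"
    using algebraic_int_quadratic algebraic_int_theta by blast
  moreover have "y \<notin> range ev"
  proof
    assume "y \<in> range ev"
    then obtain B where "y = ev B"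
      by blast
    then have "ev (\<phi> * w) = ev (of_nat p * B)"
      using p0 by (simp add: y_def int_eval_simps field_simps)
    then obtain h where h: "\<phi> * w - of_nat p * B = g * h"
      unfolding ev_eq_iff by blast
    \<comment> \<open>The expansion of g is inserted and the multiples of p are collected on the
      right. As p does not divide 1 - \<phi> h, it must divide w and hence the monic g, a
      contradiction.\<close>
    have "(\<phi> * w) * (1 - \<phi> * h) = of_nat p * (B + (of_nat p * u + \<phi> * v) * h)"
    proof -
      have "(\<phi> * w) * (1 - \<phi> * h) = (\<phi> * w - g * h) + of_nat p * ((of_nat p * u + \<phi> * v) * h)"
        unfolding uvw by (simp add: algebra_simps power2_eq_square)
      also have "\<phi> * w - g * h = of_nat p * B"
        using h by (simp add: algebra_simps)
      finally show ?thesis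
        by (simp only: distrib_left)
    qed
    then have "of_nat p dvd (\<phi> * w) * (1 - \<phi> * h)"
      by simp
    moreover have "\<not> of_nat p dvd 1 - \<phi> * h"
    proof
      assume "of_nat p dvd 1 - \<phi> * h"
      then have "(1 - \<phi> * h) + \<phi> * h \<in> pair_ideal p \<phi>"
        by (intro pair_ideal_add pair_ideal_dvd pair_ideal_mult_right pair_ideal_generator)
      then show False
        using one_notin_pair_ideal[OF p \<phi>] by simp
    qed
    ultimately have "of_nat p dvd \<phi> * w"
      using prime_elem_dvd_multD[OF prime_elem_of_nat_poly[OF p]] by blast
    moreover have "\<not> of_nat p dvd \<phi>"
      using not_of_nat_dvd_monic[OF p \<phi>(1)] .
    ultimately have "of_nat p dvd w"
      using prime_elem_dvd_multD[OF prime_elem_of_nat_poly[OF p]] by blast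
    then have "of_nat p dvd g"
      unfolding uvw by (simp add: power2_eq_square mult.assoc)
    then show False
      using not_of_nat_dvd_monic[OF p monic_g] by blast
  qed
  ultimately show thesis
    using that unfolding y_def by blast
qed

lemma range_ev_add: "x \<in> range ev \<Longrightarrow> y \<in> range ev \<Longrightarrow> x + y \<in> range ev"
  by (auto simp flip: int_eval_simps)

lemma range_ev_mult: "x \<in> range ev \<Longrightarrow> y \<in> range ev \<Longrightarrow> x * y \<in> range ev"
  by (auto simp flip: int_eval_simps)

text \<open>
  Among the elements outside \<open>\<int>[\<theta>]\<close>, choose one whose conductor contains a monic
  polynomial of least degree; that conductor is then a maximal ideal.
\<close>

lemma exists_maximal_conductor:
  assumes p: "prime p" and \<alpha>0: "algebraic_int \<alpha>0" "\<alpha>0 \<notin> range ev" "of_nat p * \<alpha>0 \<in> range ev"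
  obtains \<alpha> \<phi> where "algebraic_int \<alpha>" "\<alpha> \<notin> range ev" "maximal_pair p \<phi>"
    "{B. ev B * \<alpha> \<in> range ev} = pair_ideal p \<phi>"
proof -
  \<comment> \<open>Demanding that p \<alpha> lie in \<int>[\<theta>] keeps p in the conductor; the
    pair with g is a candidate because g(\<theta>) = 0.\<close>
  define cand where "cand = (\<lambda>(\<alpha>, t). algebraic_int \<alpha> \<and> \<alpha> \<notin> range ev
    \<and> of_nat p * \<alpha> \<in> range ev \<and> monic t \<and> ev t * \<alpha> \<in> range ev)"
  have "cand (\<alpha>0, g)"
    using \<alpha>0 monic_g root_g by (auto simp: cand_def intro!: range_eqI[of _ _ 0])
  then obtain \<alpha> \<phi> where c: "cand (\<alpha>, \<phi>)"
    and min: "\<And>\<beta> t. cand (\<beta>, t) \<Longrightarrow> degree \<phi> \<le> degree t"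
    using ex_has_least_nat[of cand _ "\<lambda>(\<alpha>, t). degree t"] by fastforce
  then have \<alpha>: "algebraic_int \<alpha>" "\<alpha> \<notin> range ev" "of_nat p * \<alpha> \<in> range ev"
    and \<phi>: "monic \<phi>" "ev \<phi> * \<alpha> \<in> range ev"
    by (simp_all add: cand_def)
  define J where "J = {B. ev B * \<alpha> \<in> range ev}"
  have J_add: "a + b \<in> J" if "a \<in> J" "b \<in> J" for a b
    using range_ev_add[of "ev a * \<alpha>" "ev b * \<alpha>"] that by (simp add: J_def int_eval_simps distrib_right)
  have J_mult: "c * a \<in> J" if "a \<in> J" for a c
    using range_ev_mult[of "ev c" "ev a * \<alpha>"] that by (simp add: J_def int_eval_simps mult.assoc)
  have J_one: "1 \<notin> J"
    using \<alpha>(2) by (simp add: J_def)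
  have p_J: "of_nat p \<in> J" and \<phi>_J: "\<phi> \<in> J"
    using \<alpha>(3) \<phi>(2) by (simp_all add: J_def int_eval_simps)
  have sub: "pair_ideal p \<phi> \<subseteq> J"
  proof
    fix x assume "x \<in> pair_ideal p \<phi>"
    then obtain a b where "x = a * of_nat p + b * \<phi>"
      unfolding pair_ideal_def by (auto simp: mult.commute)
    then show "x \<in> J"
      using J_add J_mult p_J \<phi>_J by simp
  qed
  have deg: "degree \<phi> > 0"
  proof (rule ccontr)
    assume "\<not> degree \<phi> > 0"
    then have "\<phi> = 1"
      using \<phi>(1) monic_degree_0 by blast
    then show False
      using \<phi>_J J_one by simp
  qed
  have maximal: "\<exists>x. 1 - h * x \<in> pair_ideal p \<phi>" if h: "h \<notin> pair_ideal p \<phi>" for h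
  proof (rule ccontr)
    assume no: "\<nexists>x. 1 - h * x \<in> pair_ideal p \<phi>"
    \<comment> \<open>\<open>K\<close> is the ideal (p, \<phi>, h). If h is not invertible modulo
      (p, \<phi>), \<open>K\<close> is proper and hence of the form (p, t).\<close>
    define K where "K = {a + h * c | a c. a \<in> pair_ideal p \<phi>}"
    have KI: "a + h * c \<in> K" if "a \<in> pair_ideal p \<phi>" for a c
      using that by (auto simp: K_def)
    have K_add: "x + y \<in> K" if xy: "x \<in> K" "y \<in> K" for x y
    proof -
      obtain a c a' c' where "a \<in> pair_ideal p \<phi>" "x = a + h * c" "a' \<in> pair_ideal p \<phi>" "y = a' + h * c'"
        using xy by (auto simp: K_def)
      then show ?thesis
        using KI[of "a + a'" "c + c'"] by (simp add: algebra_simps pair_ideal_add)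
    qed
    have K_mult: "d * x \<in> K" if x: "x \<in> K" for x d
    proof -
      obtain a c where "a \<in> pair_ideal p \<phi>" "x = a + h * c"
        using x by (auto simp: K_def)
      then show ?thesis
        using KI[OF pair_ideal_mult, of a d "d * c"] by (simp add: algebra_simps)
    qed
    have K_one: "1 \<notin> K"
    proof
      assume "1 \<in> K"
      then obtain a c where "a \<in> pair_ideal p \<phi>" "1 = a + h * c"
        by (auto simp: K_def)
      then show False
        using no by (metis add_diff_cancel_right')
    qed
    have p_K: "of_nat p \<in> K" and \<phi>_K: "\<phi> \<in> K"
      using KI[OF pair_ideal_of_nat, of 0] KI[OF pair_ideal_generator, of 0] by simp_all
    have h_K: "h \<in> K"
      using KI[OF pair_ideal_dvd[of p 0], of 1] by simp
    obtain t where t: "monic t" "degree t > 0" "K = pair_ideal p t"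
      and small: "\<And>r. r \<in> K \<Longrightarrow> r = 0 \<or> degree r < degree t \<Longrightarrow> of_nat p dvd r"
      using ideal_eq_pair_ideal[OF p p_K K_add K_mult K_one \<phi>_K \<phi>(1)] by metis
    show False
    proof (cases "degree t < degree \<phi>")
      case False
      obtain s r where sr: "h = \<phi> * s + r" "r = 0 \<or> degree r < degree \<phi>"
        using monic_division[OF \<phi>(1)] by blast
      have "h + (- s) * \<phi> \<in> K"
        by (intro K_add K_mult h_K \<phi>_K)
      then have "r \<in> K"
        by (simp add: sr(1) mult.commute)
      then have "of_nat p dvd r"
        using small sr(2) False by fastforce
      then have "h \<in> pair_ideal p \<phi>"
        unfolding sr(1) by (intro pair_ideal_add pair_ideal_dvd pair_ideal_mult_right pair_ideal_generator)
      then show False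
        using h by simp
    next
      case True
      \<comment> \<open>Here t is a proper divisor of \<phi> modulo p with cofactor s. By minimality
        t(\<theta>) \<alpha> is still outside \<int>[\<theta>], and its conductor contains the monic
        s of degree below that of \<phi>, against the choice of \<phi>.\<close>
      obtain s r where sr: "\<phi> = t * s + r" "r = 0 \<or> degree r < degree t"
        using monic_division[OF t(1)] by blast
      have "\<phi> + (- s) * t \<in> K"
        using pair_ideal_generator[of t p] unfolding t(3)[symmetric] by (intro K_add K_mult \<phi>_K)
      then have "r \<in> K"
        by (simp add: sr(1) mult.commute)
      then have pr: "of_nat p dvd r"
        using small sr(2) by blast
      have "s \<noteq> 0"
        using pr sr(1) not_of_nat_dvd_monic[OF p \<phi>(1)] by auto
      have dts: "degree (t * s) = degree t + degree s"
        using \<open>s \<noteq> 0\<close> t(1) by (intro degree_mult_eq) auto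
      then have dr: "degree r < degree (t * s)"
        using sr(2) t(2) by auto
      have "lead_coeff \<phi> = lead_coeff (t * s)" "degree \<phi> = degree (t * s)"
        unfolding sr(1) using dr by (simp_all add: degree_add_eq_left coeff_eq_0)
      moreover have "lead_coeff (t * s) = lead_coeff s"
        by (simp only: lead_coeff_mult t(1) mult_1)
      ultimately have s: "monic s" "degree s < degree \<phi>"
        using \<phi>(1) t(2) dts by (metis, simp)
      have t_J: "ev t * \<alpha> \<notin> range ev"
        using min[of \<alpha> t] \<alpha> t(1) True by (auto simp: cand_def)
      have "cand (ev t * \<alpha>, s)"
        unfolding cand_def prod.case
      proof (intro conjI t_J s(1))
        show "algebraic_int (ev t * \<alpha>)"
          using \<alpha>(1) algebraic_int_theta by (intro algebraic_int_times algebraic_int_poly)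
        show "of_nat p * (ev t * \<alpha>) \<in> range ev"
          using range_ev_mult[of "ev t", OF _ \<alpha>(3)] by (simp add: algebra_simps)
        have "\<phi> + (- 1) * r \<in> J"
          using pr J_mult[OF p_J] \<phi>_J by (intro J_add J_mult) (auto elim!: dvdE simp: mult.commute)
        then show "ev s * (ev t * \<alpha>) \<in> range ev"
          by (simp add: sr(1) J_def int_eval_simps algebra_simps)
      qed
      then show False
        using min s(2) by fastforce
    qed
  qed
  have "J \<subseteq> pair_ideal p \<phi>"
  proof
    fix B assume B: "B \<in> J"
    show "B \<in> pair_ideal p \<phi>"
    proof (rule ccontr)
      assume "B \<notin> pair_ideal p \<phi>"
      then obtain x where "1 - B * x \<in> pair_ideal p \<phi>"
        using maximal by blast
      then have "(1 - B * x) + x * B \<in> J"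
        using sub B by (intro J_add J_mult) auto
      then show False
        using J_one by (simp add: mult.commute)
    qed
  qed
  then have "J = pair_ideal p \<phi>"
    using sub by blast
  moreover have "maximal_pair p \<phi>"
    using p \<phi>(1) deg maximal by unfold_locales
  ultimately show thesis
    using that \<alpha>(1,2) unfolding J_def by blast
qed

text \<open>Multiplication by \<alpha> maps \<open>m\<close> to itself, so p \<alpha> = A(\<theta>)
  and \<phi>(\<theta>) \<alpha> = C(\<theta>) with A, C in \<open>m\<close>. Then \<phi> A - p C is
  in \<open>m2\<close> and equals g h for some h. Since h lies outside \<open>m\<close>, it can be
  cancelled.\<close>

lemma in_square_if_not_maximal_order:
  assumes p: "prime p" and \<alpha>0: "algebraic_int \<alpha>0" "\<alpha>0 \<notin> range ev" "of_nat p * \<alpha>0 \<in> range ev"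
  obtains \<phi> where "maximal_pair p \<phi>" "g \<in> pair_ideal_sq p \<phi>"
proof -
  obtain \<alpha> \<phi> where \<alpha>: "algebraic_int \<alpha>" "\<alpha> \<notin> range ev" and mp: "maximal_pair p \<phi>"
    and J: "{B. ev B * \<alpha> \<in> range ev} = pair_ideal p \<phi>"
    using exists_maximal_conductor[OF assms] .
  interpret maximal_pair p \<phi> by (rule mp)
  have J_iff: "B \<in> m \<longleftrightarrow> ev B * \<alpha> \<in> range ev" for B
    using J by blast
  have g_m: "g \<in> m"
    using root_g by (auto simp: J_iff intro!: range_eqI[of _ _ 0])
  \<comment> \<open>Otherwise \<open>\<int>[\<theta>]\<close> would be a discrete valuation ring locally at \<open>m\<close>, and \<open>\<alpha>\<close> would have a pole there.\<close>
  have stable: "\<exists>U\<in>m. ev B * \<alpha> = ev U" if B: "B \<in> m" for B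
  proof -
    obtain U where U: "ev B * \<alpha> = ev U"
      using B unfolding J_iff by blast
    obtain H where H: "int_eval H \<alpha> = 0" "monic H"
      using \<alpha>(1) unfolding algebraic_int_altdef_ipoly by blast
    define d where "d = degree H"
    \<comment> \<open>\<open>W\<close> is the homogenisation B^d H(U/B), with value B(\<theta>)^d
      H(\<alpha>) = 0 at \<theta>. All its terms except U^d contain a factor B, so U^d lies in
      \<open>m\<close>.\<close>
    define W where "W = (\<Sum>i\<le>d. [:coeff H i:] * U ^ i * B ^ (d - i))"
    have "ev W = (\<Sum>i\<le>d. of_int (coeff H i) * (ev B * \<alpha>) ^ i * ev B ^ (d - i))"
      unfolding W_def U
      by (simp add: of_int_poly_hom.hom_sum poly_sum int_eval_simps of_int_hom.map_poly_hom_smult mult.assoc)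
    also have "\<dots> = (\<Sum>i\<le>d. ev B ^ d * (of_int (coeff H i) * \<alpha> ^ i))"
    proof (rule sum.cong)
      fix i assume "i \<in> {..d}"
      then have "ev B ^ d = ev B ^ i * ev B ^ (d - i)"
        by (simp flip: power_add)
      then show "of_int (coeff H i) * (ev B * \<alpha>) ^ i * ev B ^ (d - i)
          = ev B ^ d * (of_int (coeff H i) * \<alpha> ^ i)"
        by (simp add: power_mult_distrib algebra_simps)
    qed simp
    also have "\<dots> = ev B ^ d * int_eval H \<alpha>"
      by (simp add: sum_distrib_left poly_altdef d_def)
    finally have "g dvd W"
      using H(1) by (intro dvd_of_ev_eq_0) simp
    then have W_m: "W \<in> m"
      using g_m pair_ideal_mult_right by (auto elim!: dvdE)
    have W_eq: "W = (\<Sum>i<d. [:coeff H i:] * U ^ i * B ^ (d - i)) + U ^ d"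
      using H(2) by (simp add: W_def d_def lessThan_Suc_atMost[symmetric])
    have "(\<Sum>i\<in>I. [:coeff H i:] * U ^ i * B ^ (d - i)) \<in> m" if "I \<subseteq> {..<d}" "finite I" for I
      using that(2,1)
    proof (induction I)
      case empty
      then show ?case
        using pair_ideal_dvd[of p 0] by simp
    next
      case (insert i I)
      then have "B ^ (d - i) \<in> m"
        using B by (simp add: power_in_iff)
      then show ?case
        using insert by (simp only: sum.insert pair_ideal_add pair_ideal_mult insert_subset simp_thms)
    qed
    then have "W - (\<Sum>i<d. [:coeff H i:] * U ^ i * B ^ (d - i)) \<in> m"
      using W_m by (intro pair_ideal_diff) simp_all
    then have "U ^ d \<in> m"
      unfolding W_eq by simp
    then show ?thesis
      using U power_in by blast
  qed
  obtain A where A: "A \<in> m" "of_nat p * \<alpha> = ev A"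
    using stable[OF pair_ideal_of_nat] by (auto simp: int_eval_simps)
  obtain C where C: "C \<in> m" "ev \<phi> * \<alpha> = ev C"
    using stable[OF pair_ideal_generator] by blast
  have "ev (\<phi> * A) = ev (of_nat p * C)"
    by (simp add: int_eval_simps mult.left_commute flip: A(2) C(2))
  then obtain h where h: "\<phi> * A - of_nat p * C = g * h"
    unfolding ev_eq_iff by blast
  have "\<phi> * A - of_nat p * C \<in> m2"
    using A(1) C(1) by (intro pair_ideal_sq_diff pair_ideal_sq_times pair_ideal_of_nat pair_ideal_generator)
  \<comment> \<open>Otherwise p would divide A - g h2, whose value at \<theta> is p \<alpha>, and
    \<alpha> would lie in \<int>[\<theta>].\<close>
  moreover have "h \<notin> m"
  proof
    assume "h \<in> m"
    then obtain h1 h2 where h12: "h = of_nat p * h1 + \<phi> * h2"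
      unfolding pair_ideal_def by blast
    have "\<phi> * (A - g * h2) = of_nat p * (C + g * h1)"
      using h unfolding h12 by (simp add: algebra_simps)
    then have "of_nat p dvd \<phi> * (A - g * h2)"
      by simp
    moreover have "\<not> of_nat p dvd \<phi>"
      using not_of_nat_dvd_monic[OF p monic_phi] .
    ultimately obtain B where "A - g * h2 = of_nat p * B"
      using prime_elem_dvd_multD[OF prime_elem_of_nat_poly[OF p]] by (metis dvd_def)
    then have "A = of_nat p * B + g * h2"
      by (simp add: algebra_simps)
    then have "of_nat p * \<alpha> = of_nat p * ev B"
      unfolding A(2) using root_g by (simp add: int_eval_simps)
    then have "\<alpha> = ev B"
      using p by auto
    then show False
      using \<alpha>(2) by blast
  qed
  ultimately have "g \<in> m2"
    unfolding h by (rule square_cancel)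
  then show thesis
    using that mp by blast
qed

end

section \<open>The index of additive groups\<close>

lemma additive_index_eq: "additive_index M N = card ((\<lambda>a. (\<lambda>h. h + a) ` N) ` M)"
  unfolding additive_index_def A_RCOSETS_def RCOSETS_def r_coset_def
  by (simp add: ring_of_type_algebra_def image_def) (rule arg_cong[of _ _ card], auto)

lemma additive_index_eq_1_iff:
  assumes M: "0 \<in> M" and N: "0 \<in> N" "N \<subseteq> M"
    "\<And>x y. x \<in> N \<Longrightarrow> y \<in> N \<Longrightarrow> x + y \<in> N" "\<And>x. x \<in> N \<Longrightarrow> - x \<in> N"
  shows "additive_index M N = 1 \<longleftrightarrow> M \<subseteq> N"
proof
  assume "additive_index M N = 1"
  then have "\<exists>C. (\<lambda>a. (\<lambda>h. h + a) ` N) ` M = {C}"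
    by (simp only: additive_index_eq One_nat_def card_1_singleton_iff)
  then obtain C where C: "(\<lambda>a. (\<lambda>h. h + a) ` N) ` M = {C}" ..
  show "M \<subseteq> N"
  proof
    fix x assume "x \<in> M"
    then have "(\<lambda>h. h + x) ` N \<in> {C}"
      unfolding C[symmetric] by (rule image_eqI[OF refl])
    moreover have "(\<lambda>h. h + 0) ` N \<in> {C}"
      unfolding C[symmetric] by (rule image_eqI[OF refl M])
    ultimately have "(\<lambda>h. h + x) ` N = (\<lambda>h. h + 0) ` N"
      by simp
    moreover have "x \<in> (\<lambda>h. h + x) ` N"
      using N(1) by (intro image_eqI[of _ _ 0]) simp_all
    ultimately show "x \<in> N"
      by auto
  qed
next
  assume sub: "M \<subseteq> N"
  have "(\<lambda>h. h + a) ` N = N" if "a \<in> M" for a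
  proof -
    have a: "a \<in> N"
      using that sub by blast
    show ?thesis
    proof (intro equalityI subsetI)
      fix x assume "x \<in> N"
      then have "x + - a \<in> N"
        using N a by blast
      then show "x \<in> (\<lambda>h. h + a) ` N"
        by (intro image_eqI[of _ _ "x + - a"]) simp_all
    qed (use a N in auto)
  qed
  then have "(\<lambda>a. (\<lambda>h. h + a) ` N) ` M = {N}"
    using M by auto
  then show "additive_index M N = 1"
    unfolding additive_index_eq by simp
qed

text \<open>An infinite index has the junk value 0, which \<open>p\<close> divides as well.\<close>

lemma prime_dvd_additive_index:
  assumes M: "0 \<in> M" "\<And>x y. x \<in> M \<Longrightarrow> y \<in> M \<Longrightarrow> x + y \<in> M" "\<And>x. x \<in> M \<Longrightarrow> - x \<in> M"
    and N: "0 \<in> N" "N \<subseteq> M" "\<And>x y. x \<in> N \<Longrightarrow> y \<in> N \<Longrightarrow> x + y \<in> N" "\<And>x. x \<in> N \<Longrightarrow> - x \<in> N"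
    and p: "prime (p :: nat)" and x: "x \<in> M" "x \<notin> N" "of_nat p * x \<in> N"
  shows "p dvd additive_index M N"
proof -
  define G where "G = add_monoid (complex_ring\<lparr>carrier := M\<rparr>)"
  have G_simps: "carrier G = M" "a \<otimes>\<^bsub>G\<^esub> b = a + b" "\<one>\<^bsub>G\<^esub> = 0" for a b
    by (simp_all add: G_def ring_of_type_algebra_def)
  interpret comm_group G
  proof (rule comm_groupI)
    show "\<exists>y\<in>carrier G. y \<otimes>\<^bsub>G\<^esub> a = \<one>\<^bsub>G\<^esub>" if "a \<in> carrier G" for a
      using that M(3) by (intro bexI[of _ "- a"]) (simp_all add: G_simps)
  qed (use M in \<open>simp_all add: G_simps algebra_simps\<close>)
  have inv: "inv\<^bsub>G\<^esub> a = - a" if "a \<in> M" for a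
    using that M(3) by (intro inv_equality) (simp_all add: G_simps)
  have sub: "subgroup N G"
    using N by (intro subgroupI) (auto simp: G_simps inv)
  interpret normal N G
    using sub by (rule subgroup_imp_normal)
  interpret Q: group "G Mod N"
    by (rule factorgroup_is_group)
  \<comment> \<open>The coset of x is nontrivial and killed by p, so it has order p in M/N, and
    Lagrange's theorem applies.\<close>
  define c where "c = N #>\<^bsub>G\<^esub> x"
  have c: "c \<in> carrier (G Mod N)"
    using x(1) by (simp add: c_def carrier_FactGroup G_simps)
  have pow: "x [^]\<^bsub>G\<^esub> n = of_nat n * x" for n :: nat
    by (induction n) (simp_all add: G_simps algebra_simps)
  have "c [^]\<^bsub>G Mod N\<^esub> p = N #>\<^bsub>G\<^esub> (x [^]\<^bsub>G\<^esub> p)"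
    unfolding c_def using x(1) by (intro FactGroup_pow) (simp add: G_simps)
  also have "\<dots> = \<one>\<^bsub>G Mod N\<^esub>"
    using x(3) M N sub by (simp add: pow coset_join2 G_simps subset_iff)
  finally have "Q.ord c dvd p"
    using Q.pow_eq_id[OF c] by blast
  moreover have "Q.ord c \<noteq> 1"
  proof
    assume "Q.ord c = 1"
    then have "c = N"
      using Q.pow_ord_eq_1[OF c] c Q.nat_pow_eone by simp
    then show False
      using coset_join1[OF _ _ sub, of x] x by (simp add: c_def G_simps)
  qed
  ultimately have "Q.ord c = p"
    using p by (metis prime_nat_iff)
  then have "p dvd Coset.order (G Mod N)"
    using Q.ord_dvd_group_order[OF c] by simp
  also have "Coset.order (G Mod N) = additive_index M N"
    by (simp add: additive_index_def A_RCOSETS_def Coset.order_def FactGroup_def G_def)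
  finally show ?thesis .
qed

section \<open>The index of a polynomial\<close>

lemma complex_ring_inv: "x \<noteq> 0 \<Longrightarrow> inv\<^bsub>complex_ring\<^esub> x = inverse x"
proof -
  assume x: "x \<noteq> 0"
  interpret R: field complex_ring
    by (rule field_from_type_algebra)
  show ?thesis
    using x by (intro R.inv_unique'[symmetric]) (simp_all add: ring_of_type_algebra_def)
qed

lemma complex_ring_a_inv: "\<ominus>\<^bsub>complex_ring\<^esub> x = - x"
proof -
  interpret R: field complex_ring
    by (rule field_from_type_algebra)
  show ?thesis
    by (intro R.minus_equality) (simp_all add: ring_of_type_algebra_def)
qed

lemma complex_ring_simps:
  "\<one>\<^bsub>complex_ring\<^esub> = 1" "\<zero>\<^bsub>complex_ring\<^esub> = 0"
  "x \<oplus>\<^bsub>complex_ring\<^esub> y = x + y" "x \<otimes>\<^bsub>complex_ring\<^esub> y = x * y"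
  by (simp_all add: ring_of_type_algebra_def)

lemma rat_poly_common_denominator:
  "\<exists>N A. N \<noteq> 0 \<and> smult (of_int N) u = (map_poly of_int A :: rat poly)"
proof (induction u)
  case 0
  show ?case
    by (rule exI[of _ 1], rule exI[of _ 0]) simp
next
  case (pCons a u)
  then obtain N A where NA: "N \<noteq> 0" "smult (of_int N) u = (map_poly of_int A :: rat poly)"
    by blast
  obtain x y :: int where xy: "y \<noteq> 0" "of_int y * a = of_int x"
    by (cases a) (metis Fract_of_int_quotient nonzero_mult_div_cancel_left of_int_0_eq_iff
        less_irrefl times_divide_eq_right)
  have "smult (of_int (N * y)) (pCons a u) = (map_poly of_int (pCons (N * x) (smult y A)) :: rat poly)"
    using xy(2) by (simp add: of_int_hom.map_poly_pCons_hom of_int_hom.map_poly_hom_smult mult.commute mult.left_commute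
        flip: NA(2))
  then show ?case
    using NA(1) xy(1) by (metis mult_eq_0_iff)
qed

context monic_irreducible_root
begin

lemma int_adjoin_eq: "int_adjoin \<theta> = range ev"
proof (intro equalityI subsetI)
  fix x assume "x \<in> int_adjoin \<theta>"
  then show "x \<in> range ev"
    unfolding int_adjoin_def
  proof (induction rule: generate_ring.induct)
    case one
    then show ?case
      by (auto simp: complex_ring_simps intro!: range_eqI[of _ _ 1])
  next
    case (incl h)
    then show ?case
      by (auto simp: of_int_hom.map_poly_pCons_hom intro!: range_eqI[of _ _ "[:0, 1:]"])
  next
    case (a_inv h)
    then show ?case
      by (auto simp: complex_ring_a_inv simp flip: of_int_poly_hom.hom_uminus poly_minus)
  next
    case (eng_add h1 h2)
    then show ?case
      by (simp only: complex_ring_simps range_ev_add)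
  next
    case (eng_mult h1 h2)
    then show ?case
      by (simp only: complex_ring_simps range_ev_mult)
  qed
next
  fix x assume "x \<in> range ev"
  then obtain P where x: "x = ev P"
    by blast
  \<comment> \<open>\<open>generate_ring\<close> has no rule for 0, which is obtained as 1 +
    (-1).\<close>
  have zero: "0 \<in> int_adjoin \<theta>"
    using generate_ring.eng_add[OF generate_ring.one generate_ring.a_inv[OF generate_ring.one], of complex_ring "{\<theta>}"]
    by (simp add: int_adjoin_def complex_ring_simps complex_ring_a_inv)
  have add: "a + b \<in> int_adjoin \<theta>" if "a \<in> int_adjoin \<theta>" "b \<in> int_adjoin \<theta>" for a b
    using generate_ring.eng_add[of a complex_ring "{\<theta>}" b] that by (simp add: int_adjoin_def complex_ring_simps)
  have minus: "- a \<in> int_adjoin \<theta>" if "a \<in> int_adjoin \<theta>" for a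
    using generate_ring.a_inv[of a complex_ring "{\<theta>}"] that by (simp add: int_adjoin_def complex_ring_a_inv)
  have nat: "of_nat n \<in> int_adjoin \<theta>" for n
    using generate_ring.one[of complex_ring "{\<theta>}"]
    by (induction n) (auto simp: zero complex_ring_simps int_adjoin_def[symmetric] intro: add)
  have int: "of_int n \<in> int_adjoin \<theta>" for n
    by (cases n rule: int_cases2) (auto simp: nat intro: minus)
  have "ev P \<in> int_adjoin \<theta>"
  proof (induction P)
    case (pCons a P)
    then have "\<theta> * ev P \<in> int_adjoin \<theta>"
      using generate_ring.eng_mult[of \<theta> complex_ring "{\<theta>}" "ev P"]
      by (simp add: int_adjoin_def complex_ring_simps generate_ring.incl)
    then show ?case
      using int by (simp add: of_int_hom.map_poly_pCons_hom add)
  qed (simp add: zero)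
  then show "x \<in> int_adjoin \<theta>"
    unfolding x .
qed

text \<open>Clearing denominators in the Bezout inverse over \<rat> leaves a numerator in
  \<int>[\<theta>] and an integer denominator.\<close>

lemma inverse_ev:
  assumes "ev A \<noteq> 0"
  obtains N B where "N \<noteq> 0" "inverse (ev A) = ev B / of_int N"
proof -
  interpret of_rat_poly: map_poly_comm_ring_hom "of_rat :: rat \<Rightarrow> complex" ..
  have "\<not> map_poly of_int g dvd (map_poly of_int A :: rat poly)"
  proof
    assume "map_poly of_int g dvd (map_poly of_int A :: rat poly)"
    then obtain h where "map_poly of_int A = map_poly of_int g * (h :: rat poly)"
      by blast
    then have "poly (map_poly of_rat (map_poly of_int A :: rat poly)) \<theta>
        = poly (map_poly of_rat (map_poly of_int g * h)) \<theta>"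
      by simp
    then have "ev A = ev g * poly (map_poly of_rat h) \<theta>"
      by (simp add: of_rat_poly.hom_mult map_poly_map_poly o_def)
    then show False
      using assms root_g by simp
  qed
  then obtain u where u: "poly (map_poly of_rat u) \<theta> * poly (map_poly of_rat (map_poly of_int A :: rat poly)) \<theta> = (1 :: complex)"
    using bezout_rat by blast
  obtain N B where NB: "N \<noteq> 0" "smult (of_int N) u = (map_poly of_int B :: rat poly)"
    using rat_poly_common_denominator by blast
  have "poly (map_poly of_rat (smult (of_int N) u)) \<theta> = ev B"
    unfolding NB(2) by (simp add: map_poly_map_poly o_def)
  then have "of_int N * poly (map_poly of_rat u) \<theta> = ev B"
    by (simp add: of_rat_hom.map_poly_hom_smult)
  moreover have "poly (map_poly of_rat u) \<theta> * ev A = 1"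
    using u by (simp add: map_poly_map_poly o_def)
  then have "inverse (ev A) = poly (map_poly of_rat u) \<theta>"
    by (metis inverse_unique mult.commute)
  ultimately have "inverse (ev A) = ev B / of_int N"
    using NB(1) by (simp add: field_simps)
  then show thesis
    using that NB(1) by blast
qed

text \<open>Fractions A(\<theta>)/N with integer N are closed under the field operations, inversion
  being \<open>inverse_ev\<close>. At the end the sign of N moves into the numerator.\<close>

lemma rat_adjoinD:
  assumes "x \<in> rat_adjoin \<theta>"
  obtains n where "n > 0" "of_nat n * x \<in> range ev"
proof -
  have "\<exists>N A. N \<noteq> 0 \<and> x = ev A / of_int N"
    using assms unfolding rat_adjoin_def
  proof (induction rule: generate_field.induct)
    case one
    show ?case
      by (rule exI[of _ 1], rule exI[of _ 1]) (simp add: complex_ring_simps)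
  next
    case (incl h)
    then show ?case
      by (intro exI[of _ 1] exI[of _ "[:0, 1:]"]) (simp add: of_int_hom.map_poly_pCons_hom)
  next
    case (a_inv h)
    then obtain N A where "N \<noteq> 0" "h = ev A / of_int N"
      by blast
    then have "N \<noteq> 0 \<and> \<ominus>\<^bsub>complex_ring\<^esub> h = ev (- A) / of_int N"
      by (simp add: complex_ring_a_inv of_int_poly_hom.hom_uminus)
    then show ?case
      by blast
  next
    case (m_inv h)
    then obtain N A where NA: "N \<noteq> 0" "h = ev A / of_int N"
      by blast
    have h0: "h \<noteq> 0"
      using m_inv by (simp add: complex_ring_simps)
    then have "ev A \<noteq> 0"
      using NA by (metis div_0)
    then obtain M B where MB: "M \<noteq> 0" "inverse (ev A) = ev B / of_int M"
      using inverse_ev by blast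
    have "inv\<^bsub>complex_ring\<^esub> h = of_int N * inverse (ev A)"
      using complex_ring_inv[OF h0] by (simp add: NA(2) divide_inverse mult.commute)
    also have "\<dots> = ev (of_int N * B) / of_int M"
      unfolding MB(2) by (simp add: int_eval_simps of_int_poly_hom.hom_of_int)
    finally show ?case
      using MB(1) by blast
  next
    case (eng_add h1 h2)
    then obtain N A M B where "N \<noteq> 0" "h1 = ev A / of_int N" "M \<noteq> 0" "h2 = ev B / of_int M"
      by blast
    then have "N * M \<noteq> 0 \<and> h1 \<oplus>\<^bsub>complex_ring\<^esub> h2 = ev (of_int M * A + of_int N * B) / of_int (N * M)"
      by (simp add: complex_ring_simps int_eval_simps of_int_poly_hom.hom_of_int field_simps)
    then show ?case
      by blast
  next
    case (eng_mult h1 h2)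
    then obtain N A M B where "N \<noteq> 0" "h1 = ev A / of_int N" "M \<noteq> 0" "h2 = ev B / of_int M"
      by blast
    then have "N * M \<noteq> 0 \<and> h1 \<otimes>\<^bsub>complex_ring\<^esub> h2 = ev (A * B) / of_int (N * M)"
      by (simp add: complex_ring_simps int_eval_simps)
    then show ?case
      by blast
  qed
  then obtain N A where NA: "N \<noteq> 0" "x = ev A / of_int N"
    by blast
  have "of_nat (nat \<bar>N\<bar>) * x = ev (of_int (sgn N) * A)"
  proof -
    have "int (nat \<bar>N\<bar>) = sgn N * N"
      by (simp add: sgn_if)
    then have "of_nat (nat \<bar>N\<bar>) = (of_int (sgn N * N) :: complex)"
      by (metis of_int_of_nat_eq)
    then show ?thesis
      using NA by (simp add: int_eval_simps of_int_poly_hom.hom_of_int)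
  qed
  then show thesis
    using that[of "nat \<bar>N\<bar>"] NA(1) by auto
qed

lemma rat_adjoin_mem: "ev A / of_nat n \<in> rat_adjoin \<theta>" if "n > 0"
proof -
  interpret R: field complex_ring
    by (rule field_from_type_algebra)
  have sub: "subfield (rat_adjoin \<theta>) complex_ring"
    unfolding rat_adjoin_def
    by (rule R.generate_field_is_subfield) (simp add: ring_of_type_algebra_def)
  have "generate_ring complex_ring {\<theta>} \<subseteq> rat_adjoin \<theta>"
  proof
    fix x assume "x \<in> generate_ring complex_ring {\<theta>}"
    then show "x \<in> rat_adjoin \<theta>"
      unfolding rat_adjoin_def by induction (auto intro: generate_field.intros)
  qed
  then have ev: "ev P \<in> rat_adjoin \<theta>" for P
    using int_adjoin_eq unfolding int_adjoin_def by blast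
  have "inv\<^bsub>complex_ring\<^esub> (of_nat n) \<in> rat_adjoin \<theta>"
    using that ev[of "of_nat n"] unfolding rat_adjoin_def
    by (intro generate_field.m_inv) (simp_all add: complex_ring_simps int_eval_simps)
  then have "ev A \<otimes>\<^bsub>complex_ring\<^esub> inv\<^bsub>complex_ring\<^esub> (of_nat n) \<in> rat_adjoin \<theta>"
    using ev unfolding rat_adjoin_def by (intro generate_field.eng_mult)
  then show ?thesis
    using that by (simp add: complex_ring_simps complex_ring_inv divide_inverse)
qed

section \<open>The ring of integers and the index of \<int>[\<theta>] in it\<close>

lemma rat_adjoin_add: "x \<in> rat_adjoin \<theta> \<Longrightarrow> y \<in> rat_adjoin \<theta> \<Longrightarrow> x + y \<in> rat_adjoin \<theta>"
  using generate_field.eng_add[of x complex_ring "{\<theta>}" y] by (simp add: rat_adjoin_def complex_ring_simps)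

lemma rat_adjoin_minus: "x \<in> rat_adjoin \<theta> \<Longrightarrow> - x \<in> rat_adjoin \<theta>"
  using generate_field.a_inv[of x complex_ring "{\<theta>}"] by (simp add: rat_adjoin_def complex_ring_a_inv)

abbreviation O_K :: "complex set" where "O_K \<equiv> ring_of_integers (rat_adjoin \<theta>)"

lemma ring_of_integers_add: "x \<in> O_K \<Longrightarrow> y \<in> O_K \<Longrightarrow> x + y \<in> O_K"
  by (simp add: ring_of_integers_def rat_adjoin_add algebraic_int_plus)

lemma ring_of_integers_minus: "x \<in> O_K \<Longrightarrow> - x \<in> O_K"
  by (simp add: ring_of_integers_def rat_adjoin_minus)

lemma range_ev_subset: "range ev \<subseteq> O_K"
  using rat_adjoin_mem[of 1] by (auto simp: ring_of_integers_def algebraic_int_poly algebraic_int_theta)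

lemma range_ev_minus: "x \<in> range ev \<Longrightarrow> - x \<in> range ev"
  by (auto simp flip: of_int_poly_hom.hom_uminus poly_minus)

lemma zero_in_range_ev: "0 \<in> range ev"
  by (rule range_eqI[of _ _ 0]) simp

lemma index_eq_1_iff: "additive_index O_K (int_adjoin \<theta>) = 1 \<longleftrightarrow> O_K \<subseteq> range ev"
  unfolding int_adjoin_eq using range_ev_subset zero_in_range_ev
  by (intro additive_index_eq_1_iff range_ev_add range_ev_minus) auto

text \<open>The fraction A(\<theta>)/p gives a class of order p in the quotient. Divisibility by
  this very prime, rather than just index different from 1, is what condition (2) is tested
  against.\<close>

lemma prime_dvd_index_if_in_square:
  assumes p: "prime p" and \<phi>: "monic \<phi>" "degree \<phi> > 0" "g \<in> pair_ideal_sq p \<phi>"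
  shows "p dvd additive_index O_K (int_adjoin \<theta>)"
proof -
  obtain A where A: "algebraic_int (ev A / of_nat p)" "ev A / of_nat p \<notin> range ev"
    using not_maximal_order_if_in_square[OF assms] .
  have p0: "p > 0"
    using prime_gt_0_nat[OF p] .
  show ?thesis
    unfolding int_adjoin_eq
  proof (rule prime_dvd_additive_index[OF _ ring_of_integers_add ring_of_integers_minus
        zero_in_range_ev range_ev_subset range_ev_add range_ev_minus p _ A(2)])
    show "ev A / of_nat p \<in> O_K"
      using A(1) rat_adjoin_mem[OF p0] by (simp add: ring_of_integers_def)
    show "of_nat p * (ev A / of_nat p) \<in> range ev"
      using p0 by simp
    show "0 \<in> O_K"
      using zero_in_range_ev range_ev_subset by blast
  qed
qed

text \<open>Take an integral x of the field outside \<int>[\<theta>], the least n > 0 with n x in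
  \<int>[\<theta>], and a prime factor p of n. Then (n/p) x is outside \<int>[\<theta>], while its
  p-fold is inside.\<close>

lemma in_square_if_index_neq_1:
  assumes "additive_index O_K (int_adjoin \<theta>) \<noteq> 1"
  obtains p \<phi> where "maximal_pair p \<phi>" "g \<in> pair_ideal_sq p \<phi>"
proof -
  obtain x where x: "x \<in> rat_adjoin \<theta>" "algebraic_int x" "x \<notin> range ev"
    using assms unfolding index_eq_1_iff by (auto simp: ring_of_integers_def)
  define Q where "Q n \<longleftrightarrow> n > 0 \<and> of_nat n * x \<in> range ev" for n :: nat
  define n where "n = (LEAST n. Q n)"
  have "\<exists>n. Q n"
    using rat_adjoinD[OF x(1)] unfolding Q_def by metis
  then have n: "Q n"
    unfolding n_def by (rule LeastI_ex)
  have "n \<noteq> 1"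
    using n x(3) by (auto simp: Q_def)
  then obtain p where p: "prime p" "p dvd n"
    using prime_factor_nat by blast
  then obtain r where r: "n = p * r"
    by blast
  have "r < n" "r > 0"
    using n prime_gt_1_nat[OF p(1)] by (auto simp: Q_def r)
  then have "of_nat r * x \<notin> range ev"
    using not_less_Least[of r Q] unfolding n_def[symmetric] by (auto simp: Q_def)
  moreover have "algebraic_int (of_nat r * x)"
    using x(2) by (intro algebraic_int_times) (auto intro: int_imp_algebraic_int)
  moreover have "of_nat p * (of_nat r * x) \<in> range ev"
    using n by (simp add: Q_def r mult.assoc)
  ultimately show thesis
    using in_square_if_not_maximal_order[OF p(1)] that by blast
qed

end

section \<open>Monogenicity in terms of squares of ideals\<close>

lemma monic_irreducible_root_some:
  assumes "monic g" "irreducible_over_rat g"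
  shows "monic_irreducible_root g (SOME z. int_eval g z = 0)"
proof -
  have "degree g \<noteq> 0"
  proof
    assume "degree g = 0"
    then have "g = 1"
      using assms(1) monic_degree_0 by blast
    then show False
      using assms(2) by (simp add: irreducible_over_rat_def)
  qed
  then have "\<not> constant (poly (map_poly of_int g :: complex poly))"
    by (simp add: constant_degree)
  then have "\<exists>z. int_eval g z = 0"
    by (rule fundamental_theorem_of_algebra)
  then have "int_eval g (SOME z. int_eval g z = 0) = 0"
    by (rule someI_ex)
  with assms show ?thesis
    by unfold_locales
qed

lemma prime_dvd_poly_index:
  assumes "monic g" "irreducible_over_rat g"
    and "prime p" "monic \<phi>" "degree \<phi> > 0" "g \<in> pair_ideal_sq p \<phi>"
  shows "p dvd poly_index g"
  using monic_irreducible_root.prime_dvd_index_if_in_square[OF monic_irreducible_root_some[OF assms(1,2)] assms(3-6)]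
  by (simp add: poly_index_def Let_def)

lemma not_monogenicE:
  assumes "monic g" "irreducible_over_rat g" "\<not> monogenic g"
  obtains p \<phi> where "maximal_pair p \<phi>" "g \<in> pair_ideal_sq p \<phi>"
  using monic_irreducible_root.in_square_if_index_neq_1[OF monic_irreducible_root_some[OF assms(1,2)]] assms
  by (auto simp: monogenic_def poly_index_def Let_def)

lemma not_in_square_if_monogenic:
  assumes "monogenic g" "prime p" "monic \<phi>" "degree \<phi> > 0"
  shows "g \<notin> pair_ideal_sq p \<phi>"
  using prime_dvd_poly_index[of g p \<phi>] assms by (auto simp: monogenic_def)

section \<open>Substituting a power of the variable\<close>

lemma irreducible_of_irreducible_pcompose:
  fixes F :: "'a :: field poly"
  assumes "irreducible (pcompose F (monom 1 n))" "n > 0"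
  shows "irreducible F"
proof (rule irreducibleI)
  show "F \<noteq> 0"
    using assms(1) by auto
  show "\<not> is_unit F"
    using assms(1) by (auto simp: is_unit_poly_iff irreducible_def)
  fix a b assume "F = a * b"
  then have "is_unit (pcompose a (monom 1 n)) \<or> is_unit (pcompose b (monom 1 n))"
    using assms(1) irreducibleD by (metis pcompose_mult)
  \<comment> \<open>The substitution multiplies degrees by n > 0, so only constants become
    constant.\<close>
  moreover have "is_unit c" if "is_unit (pcompose c (monom 1 n))" for c :: "'a poly"
  proof -
    have "c \<noteq> 0"
      using that by auto
    moreover have "degree c * n = 0"
      using that is_unit_iff_degree[of "pcompose c (monom 1 n)"]
      by (cases "pcompose c (monom 1 n) = 0") (auto simp: degree_pcompose degree_monom_eq)
    ultimately show ?thesis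
      using assms(2) by (simp add: is_unit_iff_degree)
  qed
  ultimately show "is_unit a \<or> is_unit b"
    by blast
qed

lemma subst_power_mult: "subst_power f (m * n) = pcompose (subst_power f m) (monom 1 n)"
  by (simp add: subst_power_def pcompose_monom_monom)

lemma subst_power_1: "subst_power f 1 = f"
  by (simp add: subst_power_def monom_altdef)

lemma monic_pcompose_monom: "monic f \<Longrightarrow> n > 0 \<Longrightarrow> monic (pcompose f (monom 1 n))" for f :: "int poly"
  using lead_coeff_comp[of "monom 1 n" f] by (simp add: degree_monom_eq)

lemma irreducible_subst_power_dvd:
  assumes "irreducible_over_rat (subst_power f k)" "t dvd k" "k > 0"
  shows "irreducible_over_rat (subst_power f t)"
proof -
  obtain s where s: "k = t * s"
    using assms(2) by blast
  have "map_poly of_int (subst_power f k) = pcompose (map_poly of_int (subst_power f t) :: rat poly) (monom 1 s)"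
    unfolding s subst_power_mult by (simp add: of_int_hom.map_poly_pcompose of_int_hom.map_poly_hom_monom)
  then show ?thesis
    using assms(1,3) irreducible_of_irreducible_pcompose[of _ s]
    unfolding irreducible_over_rat_def by (simp add: s)
qed

lemma pair_ideal_sq_pcompose:
  assumes "G \<in> pair_ideal_sq p \<phi>"
  shows "pcompose G q \<in> pair_ideal_sq p (pcompose \<phi> q)"
proof -
  obtain a b c where "G = of_nat p ^ 2 * a + of_nat p * \<phi> * b + \<phi> ^ 2 * c"
    using assms unfolding pair_ideal_sq_def by blast
  then have "pcompose G q = of_nat p ^ 2 * pcompose a q + of_nat p * pcompose \<phi> q * pcompose b q
      + pcompose \<phi> q ^ 2 * pcompose c q"
    by (simp add: pcompose_add pcompose_mult pcompose_hom.hom_power pcompose_hom.hom_of_nat)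
  then show ?thesis
    unfolding pair_ideal_sq_def by blast
qed

section \<open>The constant coefficient and ideals containing x\<close>

lemma squarefree_int_iff: "squarefree (n :: int) \<longleftrightarrow> (\<forall>p::nat. prime p \<longrightarrow> \<not> int p ^ 2 dvd n)"
proof
  assume "squarefree n"
  show "\<forall>p::nat. prime p \<longrightarrow> \<not> int p ^ 2 dvd n"
  proof (intro allI impI notI)
    fix p :: nat assume "prime p" "int p ^ 2 dvd n"
    then have "int p dvd 1"
      using squarefreeD[OF \<open>squarefree n\<close>] by blast
    then show False
      using \<open>prime p\<close> by auto
  qed
next
  assume *: "\<forall>p::nat. prime p \<longrightarrow> \<not> int p ^ 2 dvd n"
  show "squarefree n"
  proof (rule squarefreeI)
    fix x assume x: "x ^ 2 dvd n"
    show "is_unit x"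
    proof (rule ccontr)
      assume "\<not> is_unit x"
      then have "nat \<bar>x\<bar> \<noteq> 1"
        by auto
      then obtain p where p: "prime p" "p dvd nat \<bar>x\<bar>"
        using prime_factor_nat by blast
      then have "int p dvd x"
        by simp
      then have "int p ^ 2 dvd n"
        using x by (meson dvd_power_same dvd_trans)
      then show False
        using * p(1) by blast
    qed
  qed
qed

text \<open>From f = a + x h follows f(x^k) = a + x^k h(x^k), where p^2 divides a and, as k \<ge> 2,
  x^2 divides x^k.\<close>

lemma subst_power_in_square:
  assumes "int p ^ 2 dvd poly f 0" "k \<ge> 2"
  shows "subst_power f k \<in> pair_ideal_sq p (monom 1 1)"
proof -
  obtain c where c: "poly f 0 = int p ^ 2 * c"
    using assms(1) by blast
  obtain a h where f: "f = pCons a h"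
    by (cases f)
  have "monom (1::int) k = monom 1 1 ^ 2 * monom 1 (k - 2)"
    using le_add_diff_inverse[OF assms(2)] by (simp only: monom_power mult_monom power_one mult_1)
  moreover have "[:a:] = of_nat p ^ 2 * [:c:]"
    using c by (simp add: f of_nat_poly power2_eq_square)
  ultimately have "subst_power f k = of_nat p ^ 2 * [:c:] + of_nat p * monom 1 1 * 0
      + monom 1 1 ^ 2 * (monom 1 (k - 2) * pcompose h (monom 1 k))"
    by (simp only: subst_power_def f pcompose_pCons mult.assoc mult_zero_right add_0_right)
  then show ?thesis
    unfolding pair_ideal_sq_def by blast
qed

text \<open>With x in \<open>m\<close>, the constant coefficient of \<phi> lies in \<open>m\<close>
  and is divisible by p. Evaluating p^2 u + p \<phi> v + \<phi>^2 w at 0 then gives a multiple of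
  p^2.\<close>

lemma (in maximal_pair) square_dvd_constant_coeff:
  assumes x: "monom 1 1 \<in> m" and g: "g \<in> m2"
  shows "int p ^ 2 dvd poly g 0"
proof -
  obtain a h where \<phi>: "\<phi> = pCons a h"
    by (cases \<phi>)
  have "\<phi> - h * monom 1 1 \<in> m"
    using x by (intro pair_ideal_diff pair_ideal_mult pair_ideal_generator)
  also have "\<phi> - h * monom 1 1 = [:a:]"
    by (simp add: \<phi> monom_altdef)
  finally have "[:a:] \<in> m" .
  \<comment> \<open>The factor \<open>sgn a\<close> turns the constant into a natural number, as
    \<open>of_nat_in_iff\<close> requires.\<close>
  then have "[:sgn a:] * [:a:] \<in> m"
    by (rule pair_ideal_mult)
  also have "[:sgn a:] * [:a:] = of_nat (nat \<bar>a\<bar>)"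
    by (simp add: of_nat_poly mult_sgn_abs sgn_if)
  finally have "p dvd nat \<bar>a\<bar>"
    using of_nat_in_iff by blast
  then have "int p dvd a"
    by simp
  then obtain b where "poly \<phi> 0 = int p * b"
    by (auto simp: \<phi>)
  moreover obtain u v w where "g = of_nat p ^ 2 * u + of_nat p * \<phi> * v + \<phi> ^ 2 * w"
    using g unfolding pair_ideal_sq_def by blast
  ultimately have "poly g 0 = int p ^ 2 * (poly u 0 + b * poly v 0 + b ^ 2 * poly w 0)"
    by (simp add: power2_eq_square algebra_simps)
  then show ?thesis
    by simp
qed

section \<open>The two implications\<close>

lemma monogenic_subst_power_dvd:
  assumes f: "monic f" and mono: "monogenic (subst_power f k)" and t: "t dvd k" "k > 0"
  shows "monogenic (subst_power f t)"
proof (rule ccontr)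
  assume not: "\<not> monogenic (subst_power f t)"
  obtain s where s: "k = t * s"
    using t(1) by blast
  have pos: "t > 0" "s > 0"
    using t(2) s by simp_all
  have "irreducible_over_rat (subst_power f t)"
    using irreducible_subst_power_dvd[OF _ t] mono by (simp add: monogenic_def)
  then obtain p \<phi> where "maximal_pair p \<phi>" and sq: "subst_power f t \<in> pair_ideal_sq p \<phi>"
    using not_monogenicE[OF _ _ not] monic_pcompose_monom[OF f pos(1)] unfolding subst_power_def by metis
  then interpret maximal_pair p \<phi>
    by simp
  \<comment> \<open>\<phi>(x^s) may be reducible modulo p; \<open>not_in_square_if_monogenic\<close>
    also covers ideals that are not maximal.\<close>
  have "subst_power f k \<in> pair_ideal_sq p (pcompose \<phi> (monom 1 s))"
    unfolding s subst_power_mult using sq by (rule pair_ideal_sq_pcompose)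
  moreover have "degree (pcompose \<phi> (monom 1 s)) > 0"
    using degree_phi pos(2) by (simp add: degree_pcompose degree_monom_eq)
  ultimately show False
    using not_in_square_if_monogenic[OF mono prime_p monic_pcompose_monom[OF monic_phi pos(2)]] by blast
qed

lemma monogenic_subst_power_if:
  assumes f: "monic f" and k: "k > 0" and irr: "irreducible_over_rat (subst_power f k)"
    and mono: "monogenic f"
    and idx: "\<And>p. prime p \<Longrightarrow> p dvd k \<Longrightarrow> \<not> p dvd poly_index (subst_power f p)"
    and sqf: "squarefree (poly f 0)"
  shows "monogenic (subst_power f k)"
proof (rule ccontr)
  assume not: "\<not> monogenic (subst_power f k)"
  obtain p \<phi> where "maximal_pair p \<phi>" and sq: "subst_power f k \<in> pair_ideal_sq p \<phi>"
    using not_monogenicE[OF _ irr not] monic_pcompose_monom[OF f k] unfolding subst_power_def by metis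
  then interpret maximal_pair p \<phi>
    by simp
  have "poly (subst_power f k) 0 = poly f 0"
    using k by (simp add: subst_power_def poly_pcompose poly_monom zero_power)
  then have x: "monom 1 1 \<notin> m"
    using square_dvd_constant_coeff[OF _ sq] sqf prime_p unfolding squarefree_int_iff by auto
  obtain l where l: "k = p ^ multiplicity p k * l" "\<not> p dvd l"
    using multiplicity_decompose'[of k p] k prime_p by (metis neq0_conv not_prime_unit)
  show False
  proof (cases "multiplicity p k")
    \<comment> \<open>Here p does not divide k, and contraction along x \<mapsto> x^k contradicts
      the monogenicity of f.\<close>
    case 0
    then have "pcompose f (monom 1 l) \<in> m2"
      using sq l(1) by (simp add: subst_power_def)
    then obtain \<psi> where "monic \<psi>" "degree \<psi> > 0" "f \<in> pair_ideal_sq p \<psi>"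
      using contraction[OF x l(2) f] by blast
    then show False
      using not_in_square_if_monogenic[OF mono prime_p] by blast
  next
    case (Suc r)
    have pk: "p dvd k"
      using l(1) unfolding Suc by (metis dvd_mult2 dvd_triv_left power_Suc)
    have "subst_power f k = pcompose (subst_power f l) (monom 1 (p ^ Suc r))"
      using l(1) unfolding Suc by (metis mult.commute subst_power_mult)
    then have "pcompose (subst_power f l) (monom 1 p) \<in> m2"
      using sq frobenius_descent by metis
    \<comment> \<open>The two substitutions commute, so f(x^(l p)) is read as the image of f(x^p)
      under x \<mapsto> x^l, along which contraction is possible.\<close>
    then have "pcompose (subst_power f p) (monom 1 l) \<in> m2"
      by (metis mult.commute subst_power_mult)
    moreover have monic: "monic (subst_power f p)"
      unfolding subst_power_def using f prime_gt_0_nat[OF prime_p] by (rule monic_pcompose_monom)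
    ultimately obtain \<psi> where "monic \<psi>" "degree \<psi> > 0" "subst_power f p \<in> pair_ideal_sq p \<psi>"
      using contraction[OF x l(2)] by blast
    then have "p dvd poly_index (subst_power f p)"
      using irreducible_subst_power_dvd[OF irr pk k] by (intro prime_dvd_poly_index[OF monic _ prime_p])
    then show False
      using idx[OF prime_p pk] by blast
  qed
qed

theorem theorem1p1:
  fixes f :: "int poly" and k :: nat
  assumes "Polynomial.lead_coeff f = 1"
    and "k \<ge> 2"
    and "irreducible_over_rat (subst_power f k)"
  shows "monogenic (subst_power f k) \<longleftrightarrow>
           monogenic f
         \<and> (\<forall>p::nat. Factorial_Ring.prime p \<longrightarrow> p dvd k \<longrightarrow> \<not> p dvd poly_index (subst_power f p))
         \<and> squarefree (poly f 0)"
proof (intro iffI conjI allI impI)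
  assume mono: "monogenic (subst_power f k)"
  have k: "k > 0"
    using assms(2) by simp
  show "monogenic f"
    using monogenic_subst_power_dvd[OF assms(1) mono _ k, of 1] unfolding subst_power_1 by simp
  show "\<not> p dvd poly_index (subst_power f p)" if "prime p" "p dvd k" for p
    using monogenic_subst_power_dvd[OF assms(1) mono that(2) k] that(1)
    by (auto simp: monogenic_def)
  show "squarefree (poly f 0)"
    unfolding squarefree_int_iff
  proof (intro allI impI notI)
    fix p :: nat assume "prime p" "int p ^ 2 dvd poly f 0"
    then show False
      using not_in_square_if_monogenic[OF mono \<open>prime p\<close>, of "monom 1 1"] subst_power_in_square assms(2)
      by (simp add: degree_monom_eq)
  qed
next
  assume "monogenic f
    \<and> (\<forall>p::nat. prime p \<longrightarrow> p dvd k \<longrightarrow> \<not> p dvd poly_index (subst_power f p))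
    \<and> squarefree (poly f 0)"
  then show "monogenic (subst_power f k)"
    using assms by (intro monogenic_subst_power_if) auto
qed

end
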